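(* Let $\mathcal{H}$ be a real Hilbert space, let $C_i\subseteq\mathcal{H}$, $i\in I:=\{1,\ldots,M\}$, be closed and convex, and assume that $C:=\bigcap_{i\in I}C_i\neq\emptyset$. For every $k=0,1,2,\ldots$ let $$T_k:=\sum_{n=1}^{N_k}\omega_n^k\prod_{j\in J_n^k}P_{C_j},$$ where $J_n^k\subseteq I$ is a string and $\omega_n^k\in(0,1)$, $\sum_{n=1}^{N_k}\omega_n^k=1$. Let $I_k:=J_1^k\cup\ldots\cup J_{N_k}^k$. Assume that $\omega_n^k\geq\omega$ (for all $k$ and $n$) for some $\omega>0$, that $m:=\sup_k\max_{1\leq n\leq N_k}|J_n^k|<\infty$, and that there is an integer $s\geq1$ such that for each $k=0,1,2,\ldots$ we have $I=I_k\cup\ldots\cup I_{k+s-1}$. Let the sequence $\{x^k\}_{k=0}^\infty\subseteq\mathcal{H}$ be an inexact orbit of the dynamic string averaging projection method defined by $\{T_k\}_{k=0}^\infty$, that is, the inequality $$\|x^{k+1}-T_kx^k\|\leq e_k$$ holds for every $k=0,1,2,\ldots$, where the sequence $\{e_k\}_{k=0}^\infty\subseteq[0,\infty)$ is summable. Then the following statements hold true: (i) There are a point $x^\infty\in C$ and, for every $i=0,1,2,\ldots$, a point $x_i^\infty\in C$ such that $T_k\cdots T_ix^i\rightharpoonup x_i^\infty$ as $k\to\infty$ for every $i$, and $x_i^\infty\to x^\infty$ as $i\to\infty$. Moreover, for all $y\in\mathcal{H}$ and all integers $k\geq i\geq0$, $$|\langle y,x^{k+1}-x^\infty\rangle|\leq|\langle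 y,T_k\cdots T_ix^i-x_i^\infty\rangle|+2\|y\|\sum_{j=i}^\infty e_j.$$ (ii) If the family $\{C_i\mid i\in I\}$ is boundedly regular, then there are a point $x^\infty\in C$ and, for every $i=0,1,2,\ldots$, a point $x_i^\infty\in C$ such that $T_k\cdots T_ix^i\to x_i^\infty$ as $k\to\infty$ for every $i$, and $x_i^\infty\to x^\infty$ as $i\to\infty$. Moreover, for all integers $k\geq i\geq0$, $$\|x^{k+1}-x^\infty\|\leq\|T_k\cdots T_ix^i-x_i^\infty\|+2\sum_{j=i}^\infty e_j.$$ (iii) If the family $\{C_i\mid i\in I\}$ is boundedly linearly regular, then there are $\kappa>0$, $c>0$, $q\in(0,1)$ and $x^\infty\in C$ such that for all integers $k\geq i\geq0$, $$\frac{1}{2\kappa}\|x^{k+1}-x^\infty\|-2\sum_{j=i}^\infty e_j\leq\max_{j\in I}d(x^{k+1},C_j)\leq cq^{k-i}+2\sum_{j=i}^\infty e_j.$$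
   Context: $\rightharpoonup$ denotes weak convergence and $\to$ norm convergence. $P_D$ denotes the metric projection onto a nonempty closed convex set $D\subseteq\mathcal{H}$ and $d(x,D)=\inf\{\|x-z\|\mid z\in D\}$. A string is a finite ordered subset $J=(j_1,\ldots,j_l)$ of $I$, of length $|J|=l$, and $\prod_{j\in J}P_{C_j}:=P_{C_{j_l}}\cdots P_{C_{j_1}}$ (composition, $P_{C_{j_1}}$ applied first). For $S\subseteq\mathcal{H}$, the family $\{C_1,\ldots,C_M\}$ of closed convex sets with nonempty intersection $C$ is regular over $S$ if for every sequence $\{y^k\}\subseteq S$, $\max_{i}d(y^k,C_i)\to0$ implies $d(y^k,C)\to0$; it is $\kappa_S$-linearly regular over $S$ if $d(x,C)\leq\kappa_S\max_{i}d(x,C_i)$ for all $x\in S$ and some constant $\kappa_S>0$. The family is boundedly regular (boundedly linearly regular) if it is regular ($\kappa_S$-linearly regular, with $\kappa_S$ possibly depending on $S$) over every bounded subset $S\subseteq\mathcal{H}$. *)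

theory Defs
  imports "HOL-Analysis.Analysis"
begin

text \<open>A real Hilbert space is a type of sort \<open>{real_inner, complete_space}\<close>.\<close>

text \<open>The library's \<open>closest_point\<close> requires \<open>heine_borel\<close>, i.e. finite dimension, so the
  metric projection is introduced here for arbitrary Hilbert spaces. It is meaningful for
  nonempty closed convex sets.\<close>

definition metric_proj :: "'a::{real_inner,complete_space} set \<Rightarrow> 'a \<Rightarrow> 'a" where
  "metric_proj D x = (THE z. z \<in> D \<and> (\<forall>y\<in>D. dist x z \<le> dist x y))"

definition weakly_converges :: "(nat \<Rightarrow> 'a::real_inner) \<Rightarrow> 'a \<Rightarrow> bool" where
  "weakly_converges u l \<longleftrightarrow> (\<forall>y. (\<lambda>k. inner y (u k)) \<longlonglongrightarrow> inner y l)"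

text \<open>A string is a list of indices; \<open>fold\<close> applies the projection of its first entry first.\<close>

definition string_proj :: "(nat \<Rightarrow> 'a::{real_inner,complete_space} set) \<Rightarrow> nat list \<Rightarrow> 'a \<Rightarrow> 'a" where
  "string_proj C J = fold (\<lambda>j. metric_proj (C j)) J"

definition string_avg ::
  "(nat \<Rightarrow> 'a::{real_inner,complete_space} set) \<Rightarrow> nat \<Rightarrow> (nat \<Rightarrow> real) \<Rightarrow> (nat \<Rightarrow> nat list) \<Rightarrow> 'a \<Rightarrow> 'a" where
  "string_avg C N w J x = (\<Sum>n=1..N. w n *\<^sub>R string_proj C (J n) x)"

text \<open>\<open>iterate T i k\<close> is the composition $T_k \cdots T_i$, with $T_i$ applied first
  (for $i \le k$).\<close>

definition iterate :: "(nat \<Rightarrow> 'a \<Rightarrow> 'a) \<Rightarrow> nat \<Rightarrow> nat \<Rightarrow> 'a \<Rightarrow> 'a" where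
  "iterate T i k = fold T [i..<Suc k]"

text \<open>Since the empty set is at distance 0 by convention of \<open>infdist\<close>, the regularity notions are
  only meaningful for families with nonempty intersection; \<open>Max\<close> requires \<open>I\<close> to be finite and
  nonempty.\<close>

definition max_dist :: "'i set \<Rightarrow> ('i \<Rightarrow> 'a::metric_space set) \<Rightarrow> 'a \<Rightarrow> real" where
  "max_dist I C x = (MAX i\<in>I. infdist x (C i))"

definition regular_over :: "'i set \<Rightarrow> ('i \<Rightarrow> 'a::metric_space set) \<Rightarrow> 'a set \<Rightarrow> bool" where
  "regular_over I C S \<longleftrightarrow>
     (\<forall>y::nat \<Rightarrow> 'a. range y \<subseteq> S \<longrightarrow> (\<lambda>k. max_dist I C (y k)) \<longlonglongrightarrow> 0 \<longrightarrow>
        (\<lambda>k. infdist (y k) (\<Inter>i\<in>I. C i)) \<longlonglongrightarrow> 0)"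

definition linearly_regular_over ::
  "'i set \<Rightarrow> ('i \<Rightarrow> 'a::metric_space set) \<Rightarrow> real \<Rightarrow> 'a set \<Rightarrow> bool" where
  "linearly_regular_over I C \<kappa> S \<longleftrightarrow>
     \<kappa> > 0 \<and> (\<forall>x\<in>S. infdist x (\<Inter>i\<in>I. C i) \<le> \<kappa> * max_dist I C x)"

definition boundedly_regular :: "'i set \<Rightarrow> ('i \<Rightarrow> 'a::metric_space set) \<Rightarrow> bool" where
  "boundedly_regular I C \<longleftrightarrow> (\<forall>S. bounded S \<longrightarrow> regular_over I C S)"

definition boundedly_linearly_regular :: "'i set \<Rightarrow> ('i \<Rightarrow> 'a::metric_space set) \<Rightarrow> bool" where
  "boundedly_linearly_regular I C \<longleftrightarrow>
     (\<forall>S. bounded S \<longrightarrow> (\<exists>\<kappa>. linearly_regular_over I C \<kappa> S))"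

end

theory Submission
  imports Defs
begin

text \<open>
  Let \<open>K\<close> be the intersection of the sets \<open>C i\<close>. For a single projection \<open>P\<close> onto \<open>C j\<close> and
  \<open>c \<in> K\<close>, the obtuse angle property gives
  \<open>(norm (P z - z))\<^sup>2 \<le> (norm (z - c))\<^sup>2 - (norm (P z - c))\<^sup>2\<close>.
  Up to a constant factor, this estimate and the corresponding one for the distances to the sets
  visited are stable under composition and under averages whose weights are bounded below
  (\<open>strongly_fejer_comp\<close>, \<open>strongly_fejer_average\<close>). They therefore hold for strings, for the
  operators \<open>T k\<close>, and for products of \<open>s\<close> consecutive \<open>T k\<close>, which visit all the sets
  (\<open>orbit_window\<close>). So an exact orbit \<open>Y\<close> is Fejer monotone with respect to \<open>K\<close>, and its distance
  to every \<open>C j\<close> tends to \<open>0\<close>.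

  The projections of \<open>Y n\<close> onto \<open>K\<close> converge in norm to a point \<open>p\<close>
  (\<open>fejer_proj_convergent\<close>). Every weak cluster point of \<open>Y\<close> lies in all \<open>C j\<close>, and the obtuse
  angle property of the projections onto \<open>K\<close> forces it to be \<open>p\<close>; hence \<open>Y\<close> converges weakly to
  \<open>p\<close> (\<open>fejer_weak_limit\<close>). Under bounded regularity the distance of \<open>Y n\<close> to \<open>K\<close> tends to \<open>0\<close>
  and the convergence is in norm, because \<open>norm (Y n - p) \<le> 2 * infdist (Y n) K\<close>
  (\<open>fejer_dist_limit\<close>). Under bounded linear regularity the window estimate makes the distance to
  \<open>K\<close> decay geometrically (\<open>orbit_linear_rate\<close>).

  For the inexact orbit \<open>x\<close>, let \<open>p i\<close> be the limit of the exact orbit restarted from \<open>x i\<close>. All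
  operators are nonexpansive, so \<open>x\<close> deviates from that orbit by at most the tail
  \<open>\<Sum>j. e (i + j)\<close>, and the points \<open>p i\<close> form a Cauchy sequence whose limit \<open>x_inf\<close> satisfies
  \<open>norm (p i - x_inf) \<le> (\<Sum>j. e (i + j))\<close> (\<open>orbit_limits\<close>). The error estimates then follow from the
  triangle inequality; for the lower estimate under linear regularity the orbit restarted at
  \<open>x (Suc k)\<close> is used.
\<close>

section \<open>Nested closed convex sets and the metric projection\<close>

lemma dist_le_by_midpoint:
  fixes a b x :: "'a::real_inner"
  assumes "convex D" "a \<in> D" "b \<in> D" "0 \<le> d" and d: "\<And>z. z \<in> D \<Longrightarrow> d \<le> dist x z"
  shows "(dist a b)\<^sup>2 \<le> 2 * (dist x a)\<^sup>2 + 2 * (dist x b)\<^sup>2 - 4 * d\<^sup>2"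
proof -
  let ?m = "(1/2) *\<^sub>R a + (1/2) *\<^sub>R b"
  have "?m \<in> D"
    using assms(1-3) by (auto intro!: convexD)
  then have "d\<^sup>2 \<le> (dist x ?m)\<^sup>2"
    using d \<open>0 \<le> d\<close> by (intro power_mono) auto
  moreover have "(dist a b)\<^sup>2 + 4 * (dist x ?m)\<^sup>2 = 2 * (dist x a)\<^sup>2 + 2 * (dist x b)\<^sup>2"
    by (simp add: dist_norm power2_norm_eq_inner inner_commute algebra_simps)
  ultimately show ?thesis by simp
qed

text \<open>In a Hilbert space, a decreasing sequence of nonempty closed convex sets whose distances to
  \<open>x\<close> stay bounded, and hence converge to some \<open>d\<close>, has a common point within \<open>d\<close> of \<open>x\<close>. The
  constant sequence gives the metric projection; convex hulls of tails of a bounded sequence give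
  weak cluster points.\<close>

lemma nested_closed_convex_common_point:
  fixes K :: "nat \<Rightarrow> 'a::{real_inner,complete_space} set"
  assumes cl: "\<And>n. closed (K n)" and cv: "\<And>n. convex (K n)" and ne: "\<And>n. K n \<noteq> {}"
    and dec: "\<And>m n. m \<le> n \<Longrightarrow> K n \<subseteq> K m"
    and lim: "(\<lambda>n. infdist x (K n)) \<longlonglongrightarrow> d"
  obtains a where "\<And>n. a \<in> K n" "dist x a \<le> d"
proof -
  have mono: "incseq (\<lambda>n. infdist x (K n))"
    by (intro incseq_SucI infdist_mono dec ne) simp
  have le_d: "infdist x (K n) \<le> d" for n
    using incseq_le[OF mono lim] .
  have "0 \<le> d"
    using le_d[of 0] infdist_nonneg[of x "K 0"] by linarith
  \<comment> \<open>The near-minimizers of the distance to \<open>x\<close> in \<open>K n\<close> form closed sets that decrease, with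
    diameters tending to \<open>0\<close> by the parallelogram law, so they have a common point.\<close>
  define S where "S n = K n \<inter> cball x (d + 1 / Suc n)" for n
  have S_ne: "S n \<noteq> {}" for n
  proof -
    have "infdist x (K n) < d + 1 / Suc n"
      using le_d[of n] by (smt (verit) divide_pos_pos of_nat_0_less_iff zero_less_Suc)
    then obtain z where "z \<in> K n" "dist x z < d + 1 / Suc n"
      using ne[of n] by (auto simp: infdist_notempty cINF_less_iff)
    then show ?thesis
      by (auto simp: S_def)
  qed
  have S_dec: "S n \<subseteq> S m" if "m \<le> n" for m n
  proof -
    have "1 / real (Suc n) \<le> 1 / real (Suc m)"
      using that by (intro divide_left_mono) auto
    then show ?thesis
      using dec[OF that] by (auto simp: S_def)
  qed
  have diam: "(dist y z)\<^sup>2 \<le> 4 * (d + 1 / Suc n)\<^sup>2 - 4 * (infdist x (K n))\<^sup>2"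
    if "y \<in> S n" "z \<in> S n" for y z n
  proof -
    have "(dist y z)\<^sup>2 \<le> 2 * (dist x y)\<^sup>2 + 2 * (dist x z)\<^sup>2 - 4 * (infdist x (K n))\<^sup>2"
      using that by (intro dist_le_by_midpoint[OF cv[of n]] infdist_nonneg infdist_le) (auto simp: S_def)
    moreover have "(dist x y)\<^sup>2 \<le> (d + 1 / Suc n)\<^sup>2" "(dist x z)\<^sup>2 \<le> (d + 1 / Suc n)\<^sup>2"
      using that by (auto simp: S_def intro!: power_mono)
    ultimately show ?thesis by linarith
  qed
  have diam0: "(\<lambda>n. 4 * (d + 1 / Suc n)\<^sup>2 - 4 * (infdist x (K n))\<^sup>2) \<longlonglongrightarrow> 0"
  proof -
    have "(\<lambda>n. 4 * (d + 1 / Suc n)\<^sup>2 - 4 * (infdist x (K n))\<^sup>2) \<longlonglongrightarrow> 4 * (d + 0)\<^sup>2 - 4 * d\<^sup>2"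
      by (intro tendsto_intros lim LIMSEQ_Suc[OF lim_1_over_n])
    then show ?thesis by simp
  qed
  have "\<exists>n. \<forall>y\<in>S n. \<forall>z\<in>S n. dist y z < \<epsilon>" if "\<epsilon> > 0" for \<epsilon>
  proof -
    have "eventually (\<lambda>n. 4 * (d + 1 / Suc n)\<^sup>2 - 4 * (infdist x (K n))\<^sup>2 < \<epsilon>\<^sup>2) sequentially"
      using order_tendstoD(2)[OF diam0, of "\<epsilon>\<^sup>2"] that by simp
    then obtain n where "4 * (d + 1 / Suc n)\<^sup>2 - 4 * (infdist x (K n))\<^sup>2 < \<epsilon>\<^sup>2"
      by (auto simp: eventually_sequentially)
    then have "dist y z < \<epsilon>" if "y \<in> S n" "z \<in> S n" for y z
      using diam[OF that] \<open>\<epsilon> > 0\<close> by (intro power2_less_imp_less[of _ \<epsilon>]) auto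
    then show ?thesis by blast
  qed
  moreover have "closed (S n)" for n
    by (auto simp: S_def intro: cl)
  ultimately obtain a where a: "\<And>n. a \<in> S n"
    using decreasing_closed_nest[of S] S_ne S_dec by metis
  have "(\<lambda>n. d + 1 / Suc n) \<longlonglongrightarrow> d + 0"
    by (intro tendsto_intros LIMSEQ_Suc[OF lim_1_over_n])
  moreover have "dist x a \<le> d + 1 / Suc n" for n
    using a[of n] by (auto simp: S_def)
  ultimately have "dist x a \<le> d"
    by (intro LIMSEQ_le_const[of "\<lambda>n. d + 1 / Suc n"]) auto
  with a show ?thesis
    by (intro that) (auto simp: S_def)
qed

context
  fixes D :: "'a::{real_inner,complete_space} set"
  assumes D: "closed D" "convex D" "D \<noteq> {}"
begin

lemma metric_proj_props: "metric_proj D x \<in> D \<and> (\<forall>y\<in>D. dist x (metric_proj D x) \<le> dist x y)"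
proof -
  obtain a where a: "a \<in> D" "dist x a \<le> infdist x D"
  proof (rule nested_closed_convex_common_point[of "\<lambda>_. D" x "infdist x D"])
  qed (use D in simp_all)
  then have min: "\<forall>y\<in>D. dist x a \<le> dist x y"
    by (meson infdist_le order_trans)
  show ?thesis
    unfolding metric_proj_def
  proof (rule theI)
    show "a \<in> D \<and> (\<forall>y\<in>D. dist x a \<le> dist x y)"
      using a(1) min by (rule conjI)
    show "z = a" if "z \<in> D \<and> (\<forall>y\<in>D. dist x z \<le> dist x y)" for z
      using any_closest_point_unique[OF D(2,1), of z a x] a(1) min that by simp
  qed
qed

lemma metric_proj_in: "metric_proj D x \<in> D"
  using metric_proj_props by blast

lemma norm_metric_proj: "norm (x - metric_proj D x) = infdist x D"
proof -
  have "infdist x D \<le> dist x (metric_proj D x)"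
    by (intro infdist_le metric_proj_in)
  moreover have "dist x (metric_proj D x) \<le> infdist x D"
    using metric_proj_props D(3) by (auto simp: infdist_notempty intro!: cINF_greatest)
  ultimately show ?thesis by (simp add: dist_norm)
qed

lemma metric_proj_obtuse: "y \<in> D \<Longrightarrow> inner (x - metric_proj D x) (y - metric_proj D x) \<le> 0"
  using metric_proj_props by (intro any_closest_point_dot[OF D(2,1)]) auto

lemma metric_proj_pythagoras:
  assumes "c \<in> D"
  shows "(norm (metric_proj D x - c))\<^sup>2 + (infdist x D)\<^sup>2 \<le> (norm (x - c))\<^sup>2"
proof -
  have "(norm (x - c))\<^sup>2 = (norm (metric_proj D x - c))\<^sup>2 + (norm (x - metric_proj D x))\<^sup>2
      - 2 * inner (x - metric_proj D x) (c - metric_proj D x)"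
    by (simp add: power2_norm_eq_inner inner_commute algebra_simps)
  then show ?thesis
    using metric_proj_obtuse[OF assms, of x] by (simp add: norm_metric_proj)
qed

lemma metric_proj_nonexpansive: "norm (metric_proj D x - metric_proj D y) \<le> norm (x - y)"
proof -
  let ?p = "metric_proj D x" and ?q = "metric_proj D y"
  have "inner (x - ?p) (?q - ?p) \<le> 0" "inner (y - ?q) (?p - ?q) \<le> 0"
    by (auto intro: metric_proj_obtuse metric_proj_in)
  then have "(norm (?p - ?q))\<^sup>2 \<le> inner (x - y) (?p - ?q)"
    by (simp add: power2_norm_eq_inner inner_commute algebra_simps)
  also have "\<dots> \<le> norm (x - y) * norm (?p - ?q)"
    by (rule norm_cauchy_schwarz)
  finally show ?thesis
    by (cases "?p = ?q") (auto simp: power2_eq_square)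
qed

end

section \<open>Weak cluster points\<close>

text \<open>The point \<open>a\<close> plays the role of a weak cluster point: it lies in every closed half-space that
  eventually contains the sequence. This is all that is used of weak sequential compactness.\<close>

lemma bounded_seq_weak_cluster:
  fixes u :: "nat \<Rightarrow> 'a::{real_inner,complete_space}"
  assumes "bounded (range u)"
  obtains a where "\<And>b \<beta>. eventually (\<lambda>k. inner b (u k) \<le> \<beta>) sequentially \<Longrightarrow> inner b a \<le> \<beta>"
proof -
  define K where "K n = closure (convex hull (u ` {n..}))" for n
  have uK: "u n \<in> K n" for n
    unfolding K_def by (rule closure_subset[THEN subsetD]) (simp add: hull_inc)
  have dec: "K n \<subseteq> K m" if "m \<le> n" for m n
    unfolding K_def using that by (intro closure_mono hull_mono) auto
  have ne: "K n \<noteq> {}" for n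
    using uK by blast
  obtain B where B: "\<And>n. norm (u n) \<le> B"
    using assms by (auto simp: bounded_iff)
  have "infdist 0 (K n) \<le> B" for n
    using infdist_le2[OF uK, of 0 n B] B by simp
  moreover have "incseq (\<lambda>n. infdist 0 (K n))"
    by (intro incseq_SucI infdist_mono dec ne) simp
  ultimately obtain d where "(\<lambda>n. infdist 0 (K n)) \<longlonglongrightarrow> d"
    by (metis incseq_convergent)
  moreover have "closed (K n)" "convex (K n)" for n
    by (auto simp: K_def convex_closure convex_convex_hull)
  ultimately obtain a where a: "\<And>n. a \<in> K n"
    using nested_closed_convex_common_point[of K 0 d thesis] dec ne by metis
  show ?thesis
  proof
    fix b :: 'a and \<beta> :: real
    assume "eventually (\<lambda>k. inner b (u k) \<le> \<beta>) sequentially"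
    then obtain n where "u ` {n..} \<subseteq> {z. inner b z \<le> \<beta>}"
      by (auto simp: eventually_sequentially)
    then have "K n \<subseteq> {z. inner b z \<le> \<beta>}"
      unfolding K_def
      by (intro closure_minimal hull_minimal closed_halfspace_le convex_halfspace_le)
    then show "inner b a \<le> \<beta>"
      using a by blast
  qed
qed

text \<open>A demiclosedness principle: a weak cluster point of a sequence whose distances to \<open>D\<close> vanish
  belongs to \<open>D\<close>. The half-space used is bounded by the hyperplane through \<open>p\<close>, the projection of
  \<open>a\<close> onto \<open>D\<close>, with normal \<open>a - p\<close>.\<close>

lemma weak_cluster_in_closed_convex:
  fixes u :: "nat \<Rightarrow> 'a::{real_inner,complete_space}"
  assumes a: "\<And>b \<beta>. eventually (\<lambda>k. inner b (u k) \<le> \<beta>) sequentially \<Longrightarrow> inner b a \<le> \<beta>"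
    and D: "closed D" "convex D" "D \<noteq> {}"
    and lim: "(\<lambda>k. infdist (u k) D) \<longlonglongrightarrow> 0"
  shows "a \<in> D"
proof -
  define p where "p = metric_proj D a"
  have bound: "inner (a - p) (u k) \<le> inner (a - p) p + norm (a - p) * infdist (u k) D" for k
  proof -
    let ?q = "metric_proj D (u k)"
    have "inner (a - p) (u k - ?q) \<le> norm (a - p) * infdist (u k) D"
      using norm_cauchy_schwarz[of "a - p" "u k - ?q"] by (simp add: norm_metric_proj[OF D])
    moreover have "inner (a - p) (?q - p) \<le> 0"
      unfolding p_def by (intro metric_proj_obtuse metric_proj_in D)
    ultimately show ?thesis
      by (simp add: inner_diff_right)
  qed
  have "inner (a - p) a \<le> inner (a - p) p + \<delta>" if "\<delta> > 0" for \<delta>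
  proof (rule a)
    have "(\<lambda>k. norm (a - p) * infdist (u k) D) \<longlonglongrightarrow> norm (a - p) * 0"
      by (intro tendsto_intros lim)
    then have "eventually (\<lambda>k. norm (a - p) * infdist (u k) D < \<delta>) sequentially"
      using that by (intro order_tendstoD(2)) auto
    then show "eventually (\<lambda>k. inner (a - p) (u k) \<le> inner (a - p) p + \<delta>) sequentially"
      by eventually_elim (smt (verit) bound)
  qed
  then have "inner (a - p) a \<le> inner (a - p) p"
    by (rule field_le_epsilon)
  then have "inner (a - p) (a - p) \<le> 0"
    by (simp add: inner_diff_right)
  then have "a = p" by (metis inner_eq_zero_iff inner_ge_zero order_antisym eq_iff_diff_eq_0)
  then show ?thesis
    unfolding p_def using metric_proj_in[OF D] by metis
qed

section \<open>Fejer monotone sequences\<close>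

context
  fixes K :: "'a::{real_inner,complete_space} set" and Y :: "nat \<Rightarrow> 'a"
  assumes K: "closed K" "convex K" "K \<noteq> {}"
    and fejer_step: "\<And>n c. c \<in> K \<Longrightarrow> norm (Y (Suc n) - c) \<le> norm (Y n - c)"
begin

lemma fejer_mono: "c \<in> K \<Longrightarrow> m \<le> n \<Longrightarrow> norm (Y n - c) \<le> norm (Y m - c)"
  by (rule lift_Suc_antimono_le[of "\<lambda>n. norm (Y n - c)"]) (rule fejer_step)

lemma fejer_infdist_mono: "m \<le> n \<Longrightarrow> infdist (Y n) K \<le> infdist (Y m) K"
  by (metis dist_norm fejer_mono infdist_le2 metric_proj_in[OF K] norm_metric_proj[OF K])

lemma fejer_norm_diff_convergent:
  assumes "c \<in> K" shows "convergent (\<lambda>n. (norm (Y n - c))\<^sup>2)"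
proof -
  have "decseq (\<lambda>n. (norm (Y n - c))\<^sup>2)"
    by (simp add: decseq_def fejer_mono assms power_mono)
  then obtain l where "(\<lambda>n. (norm (Y n - c))\<^sup>2) \<longlonglongrightarrow> l"
    by (rule decseq_convergent[where B = 0]) auto
  then show ?thesis by (rule convergentI)
qed

text \<open>The projections of a Fejer monotone sequence onto the target set converge in norm, even when the
  sequence itself does not. The limit turns out to be the weak limit of the sequence.\<close>

lemma fejer_proj_convergent: "convergent (\<lambda>n. metric_proj K (Y n))"
proof -
  let ?d = "\<lambda>n. (infdist (Y n) K)\<^sup>2"
  have "decseq ?d"
    by (simp add: decseq_def fejer_infdist_mono infdist_nonneg power_mono)
  then obtain l where "?d \<longlonglongrightarrow> l"
    by (rule decseq_convergent[where B = 0]) auto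
  then have cau: "Cauchy ?d" by (rule LIMSEQ_imp_Cauchy)
  have le: "(norm (metric_proj K (Y n) - metric_proj K (Y m)))\<^sup>2 \<le> \<bar>?d m - ?d n\<bar>" if "m \<le> n" for m n
  proof -
    have c: "metric_proj K (Y m) \<in> K" by (rule metric_proj_in[OF K])
    have "(norm (Y n - metric_proj K (Y m)))\<^sup>2 \<le> ?d m"
      using fejer_mono[OF c that] by (intro power_mono) (auto simp: norm_metric_proj[OF K])
    then show ?thesis
      using metric_proj_pythagoras[OF K c, of "Y n"] by linarith
  qed
  have "Cauchy (\<lambda>n. metric_proj K (Y n))"
  proof (rule metric_CauchyI)
    fix \<epsilon> :: real assume "\<epsilon> > 0"
    then obtain N where N: "\<And>m n. m \<ge> N \<Longrightarrow> n \<ge> N \<Longrightarrow> \<bar>?d m - ?d n\<bar> < \<epsilon>\<^sup>2"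
      using metric_CauchyD[OF cau, of "\<epsilon>\<^sup>2"] by (auto simp: dist_real_def)
    have *: "dist (metric_proj K (Y n)) (metric_proj K (Y m)) < \<epsilon>" if "m \<ge> N" "m \<le> n" for m n
      using le[OF that(2)] N[of m n] that \<open>\<epsilon> > 0\<close>
      by (intro power2_less_imp_less[of _ \<epsilon>]) (auto simp: dist_norm)
    show "\<exists>N. \<forall>m\<ge>N. \<forall>n\<ge>N. dist (metric_proj K (Y m)) (metric_proj K (Y n)) < \<epsilon>"
      using * by (metis dist_commute nle_le)
  qed
  then show ?thesis by (rule Cauchy_convergent)
qed

text \<open>Both \<open>p\<close> and \<open>Y n\<close> lie within \<open>infdist (Y n) K\<close> of the projection of \<open>Y n\<close> onto \<open>K\<close>.\<close>

lemma fejer_dist_limit: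
  assumes p: "(\<lambda>n. metric_proj K (Y n)) \<longlonglongrightarrow> p"
  shows "norm (Y n - p) \<le> 2 * infdist (Y n) K"
proof -
  define c where "c = metric_proj K (Y n)"
  have c: "c \<in> K" unfolding c_def by (rule metric_proj_in[OF K])
  have "norm (metric_proj K (Y m) - c) \<le> infdist (Y n) K" if "m \<ge> n" for m
  proof -
    have "(norm (metric_proj K (Y m) - c))\<^sup>2 \<le> (norm (Y m - c))\<^sup>2"
      using metric_proj_pythagoras[OF K c, of "Y m"] by (smt (verit) zero_le_power2)
    then have "norm (metric_proj K (Y m) - c) \<le> norm (Y m - c)"
      by (rule power2_le_imp_le) simp
    also have "\<dots> \<le> norm (Y n - c)" by (rule fejer_mono[OF c that])
    finally show ?thesis by (simp add: c_def norm_metric_proj[OF K])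
  qed
  moreover have "(\<lambda>m. norm (metric_proj K (Y m) - c)) \<longlonglongrightarrow> norm (p - c)"
    by (intro tendsto_intros p)
  ultimately have "norm (p - c) \<le> infdist (Y n) K"
    by (intro LIMSEQ_le_const2) auto
  moreover have "norm (Y n - p) \<le> norm (Y n - c) + norm (p - c)"
    using norm_triangle_ineq4[of "Y n - c" "p - c"] by simp
  ultimately show ?thesis
    by (simp add: c_def norm_metric_proj[OF K])
qed

lemma fejer_weak_limit:
  assumes p: "(\<lambda>n. metric_proj K (Y n)) \<longlonglongrightarrow> p"
    and KC: "K = (\<Inter>i\<in>I. C i)" and C: "\<And>i. i \<in> I \<Longrightarrow> closed (C i)" "\<And>i. i \<in> I \<Longrightarrow> convex (C i)"
    and lim: "\<And>i. i \<in> I \<Longrightarrow> (\<lambda>n. infdist (Y n) (C i)) \<longlonglongrightarrow> 0"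
  shows "weakly_converges Y p"
proof -
  obtain c0 where c0: "c0 \<in> K" using K by blast
  define B where "B = norm (Y 0 - c0) + norm (c0 - p) + 1"
  have B: "norm (Y n - p) \<le> B" for n
    using fejer_mono[OF c0, of 0 n] norm_triangle_ineq[of "Y n - c0" "c0 - p"] by (simp add: B_def)
  have upper: "eventually (\<lambda>n. inner y (Y n - p) < \<epsilon>) sequentially" if "\<epsilon> > 0" for y \<epsilon>
  proof (rule ccontr)
    assume "\<not> ?thesis"
    then obtain r :: "nat \<Rightarrow> nat" where r: "strict_mono r" "\<And>n. \<epsilon> \<le> inner y (Y (r n) - p)"
      by (metis (no_types, lifting) not_eventually_sequentiallyD not_less)
    have "bounded (range (\<lambda>n. Y (r n)))"
    proof (rule boundedI)
      fix z assume "z \<in> range (\<lambda>n. Y (r n))"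
      then obtain n where "z = Y (r n)" by blast
      then show "norm z \<le> B + norm p"
        using B[of "r n"] norm_triangle_ineq[of "Y (r n) - p" p] by simp
    qed
    then obtain a where a: "\<And>b \<beta>. eventually (\<lambda>k. inner b (Y (r k)) \<le> \<beta>) sequentially \<Longrightarrow> inner b a \<le> \<beta>"
      by (rule bounded_seq_weak_cluster) (rule that)
    have "a \<in> C i" if "i \<in> I" for i
      using a
    proof (rule weak_cluster_in_closed_convex)
      show "C i \<noteq> {}" using K KC that by blast
      show "(\<lambda>k. infdist (Y (r k)) (C i)) \<longlonglongrightarrow> 0"
        using LIMSEQ_subseq_LIMSEQ[OF lim[OF that] r(1)] by (simp add: comp_def)
    qed (use C that in auto)
    then have "a \<in> K" using KC by blast
    \<comment> \<open>The projections \<open>q n\<close> tend to \<open>p\<close>, and \<open>a \<in> K\<close>, so the obtuse angle property at \<open>q n\<close>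
      passes to the limit and shows that \<open>a = p\<close>.\<close>
    define q where "q n = metric_proj K (Y (r n))" for n
    have q: "q \<longlonglongrightarrow> p"
      using LIMSEQ_subseq_LIMSEQ[OF p r(1)] by (simp add: comp_def q_def[abs_def])
    have bound: "inner (a - p) (Y (r n)) \<le> inner (a - p) p
        + (norm (p - q n) * norm (a - q n) + B * norm (p - q n))" for n
    proof -
      have "inner (Y (r n) - q n) (a - q n) \<le> 0"
        unfolding q_def by (rule metric_proj_obtuse[OF K \<open>a \<in> K\<close>])
      moreover have "inner (q n - p) (a - q n) \<le> norm (p - q n) * norm (a - q n)"
        using norm_cauchy_schwarz[of "q n - p" "a - q n"] by (simp add: norm_minus_commute)
      moreover have "inner (Y (r n) - p) (q n - p) \<le> B * norm (p - q n)"
        using norm_cauchy_schwarz[of "Y (r n) - p" "q n - p"]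
          mult_right_mono[OF B[of "r n"], of "norm (p - q n)"] by (simp add: norm_minus_commute)
      ultimately show ?thesis
        by (simp add: inner_commute algebra_simps)
    qed
    have lim0: "(\<lambda>n. norm (p - q n) * norm (a - q n) + B * norm (p - q n))
        \<longlonglongrightarrow> norm (p - p) * norm (a - p) + B * norm (p - p)"
      by (intro tendsto_intros q)
    have "inner (a - p) a \<le> inner (a - p) p + \<delta>" if "\<delta> > 0" for \<delta>
    proof (rule a)
      have "eventually (\<lambda>n. norm (p - q n) * norm (a - q n) + B * norm (p - q n) < \<delta>) sequentially"
        using lim0 that by (intro order_tendstoD(2)) auto
      then show "eventually (\<lambda>k. inner (a - p) (Y (r k)) \<le> inner (a - p) p + \<delta>) sequentially"
        by eventually_elim (smt (verit) bound)
    qed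
    then have "inner (a - p) a \<le> inner (a - p) p"
      by (rule field_le_epsilon)
    then have "inner (a - p) (a - p) \<le> 0"
      by (simp add: inner_diff_right)
    then have "a = p" by (metis inner_eq_zero_iff inner_ge_zero order_antisym eq_iff_diff_eq_0)
    moreover have "inner (- y) a \<le> - (inner y p + \<epsilon>)"
      using r(2) by (intro a always_eventually) (simp add: inner_diff_right algebra_simps)
    ultimately show False
      using that by simp
  qed
  show ?thesis
    unfolding weakly_converges_def
  proof (intro allI tendstoI)
    fix y and \<epsilon> :: real assume "\<epsilon> > 0"
    then have "eventually (\<lambda>n. inner y (Y n - p) < \<epsilon>) sequentially"
      "eventually (\<lambda>n. inner (- y) (Y n - p) < \<epsilon>) sequentially"
      by (auto intro!: upper simp del: inner_minus_left)
    then show "eventually (\<lambda>n. dist (inner y (Y n)) (inner y p) < \<epsilon>) sequentially"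
      by eventually_elim (auto simp: dist_real_def inner_diff_right)
  qed
qed

end

section \<open>Strongly Fejer operators\<close>

text \<open>The operator \<open>P\<close> brings every point \<open>z\<close> closer to every \<open>c \<in> K\<close>, and up to the factor \<open>L\<close> the
  decrease of the squared distance to \<open>c\<close> controls both the squared displacement of \<open>z\<close> and its squared
  distance to each \<open>C j\<close> with \<open>j \<in> A\<close>. The displacement bound is what makes the property stable
  under composition.\<close>

definition strongly_fejer ::
  "('i \<Rightarrow> 'a::real_inner set) \<Rightarrow> 'a set \<Rightarrow> real \<Rightarrow> 'i set \<Rightarrow> ('a \<Rightarrow> 'a) \<Rightarrow> bool" where
  "strongly_fejer C K L A P \<longleftrightarrow> 0 \<le> L \<and> (\<forall>z. \<forall>c\<in>K. norm (P z - c) \<le> norm (z - c) \<and>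
     (norm (P z - z))\<^sup>2 \<le> L * ((norm (z - c))\<^sup>2 - (norm (P z - c))\<^sup>2) \<and>
     (\<forall>j\<in>A. (infdist z (C j))\<^sup>2 \<le> L * ((norm (z - c))\<^sup>2 - (norm (P z - c))\<^sup>2)))"

lemma strongly_fejerD:
  assumes "strongly_fejer C K L A P" "c \<in> K"
  shows "norm (P z - c) \<le> norm (z - c)"
    and "(norm (P z - z))\<^sup>2 \<le> L * ((norm (z - c))\<^sup>2 - (norm (P z - c))\<^sup>2)"
    and "j \<in> A \<Longrightarrow> (infdist z (C j))\<^sup>2 \<le> L * ((norm (z - c))\<^sup>2 - (norm (P z - c))\<^sup>2)"
  using assms by (simp_all add: strongly_fejer_def)

lemma strongly_fejer_nonneg: "strongly_fejer C K L A P \<Longrightarrow> 0 \<le> L"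
  by (simp add: strongly_fejer_def)

lemma strongly_fejer_mono:
  assumes P: "strongly_fejer C K L A P" and "L \<le> L'" "A' \<subseteq> A"
  shows "strongly_fejer C K L' A' P"
proof -
  have "L * ((norm (z - c))\<^sup>2 - (norm (P z - c))\<^sup>2) \<le> L' * ((norm (z - c))\<^sup>2 - (norm (P z - c))\<^sup>2)"
    if "c \<in> K" for z c
    using strongly_fejerD(1)[OF P that] \<open>L \<le> L'\<close> by (intro mult_right_mono) (auto simp: power_mono)
  then show ?thesis
    using strongly_fejer_nonneg[OF P] strongly_fejerD[OF P] assms(2,3)
    unfolding strongly_fejer_def by (smt (verit, best) subsetD)
qed

lemma strongly_fejer_metric_proj:
  fixes C :: "'i \<Rightarrow> 'a::{real_inner,complete_space} set"
  assumes C: "closed (C j)" "convex (C j)" "C j \<noteq> {}" and "K \<subseteq> C j"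
  shows "strongly_fejer C K 1 {j} (metric_proj (C j))"
proof -
  have *: "(norm (metric_proj (C j) z - c))\<^sup>2 + (infdist z (C j))\<^sup>2 \<le> (norm (z - c))\<^sup>2" if "c \<in> K" for z c
    using metric_proj_pythagoras[OF C] that \<open>K \<subseteq> C j\<close> by blast
  have "norm (metric_proj (C j) z - c) \<le> norm (z - c)" if "c \<in> K" for z c
  proof (rule power2_le_imp_le)
    show "(norm (metric_proj (C j) z - c))\<^sup>2 \<le> (norm (z - c))\<^sup>2"
      using *[OF that, of z] zero_le_power2[of "infdist z (C j)"] by linarith
  qed simp
  then show ?thesis
    using * by (simp add: strongly_fejer_def norm_minus_commute[of "metric_proj _ _"] norm_metric_proj[OF C]
        algebra_simps)
qed

lemma square_sum_le_mult_sum: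
  fixes a b :: real
  assumes "a\<^sup>2 \<le> L1 * E1" "b\<^sup>2 \<le> L2 * E2" "0 \<le> L1" "0 \<le> L2" "0 \<le> E1" "0 \<le> E2"
  shows "(a + b)\<^sup>2 \<le> (L1 + L2) * (E1 + E2)"
proof -
  have "(2 * (a * b))\<^sup>2 = 4 * (a\<^sup>2 * b\<^sup>2)"
    by (simp add: power_mult_distrib)
  also have "\<dots> \<le> 4 * ((L1 * E1) * (L2 * E2))"
    using assms by (intro mult_left_mono mult_mono) auto
  also have "\<dots> \<le> (L1 * E2 + L2 * E1)\<^sup>2"
    using zero_le_power2[of "L1 * E2 - L2 * E1"] by (simp add: power2_eq_square algebra_simps)
  finally have "2 * (a * b) \<le> L1 * E2 + L2 * E1"
    by (rule power2_le_imp_le) (use assms in auto)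
  then show ?thesis
    using assms(1,2) by (simp add: power2_eq_square algebra_simps)
qed

lemma strongly_fejer_comp:
  assumes P: "strongly_fejer C K L1 A1 P" and Q: "strongly_fejer C K L2 A2 Q"
  shows "strongly_fejer C K (L1 + L2) (A1 \<union> A2) (Q \<circ> P)"
proof -
  have nn: "0 \<le> L1" "0 \<le> L2"
    using P Q by (auto intro: strongly_fejer_nonneg)
  have "norm (Q (P z) - c) \<le> norm (z - c) \<and>
      (norm (Q (P z) - z))\<^sup>2 \<le> (L1 + L2) * ((norm (z - c))\<^sup>2 - (norm (Q (P z) - c))\<^sup>2) \<and>
      (\<forall>j\<in>A1 \<union> A2. (infdist z (C j))\<^sup>2 \<le> (L1 + L2) * ((norm (z - c))\<^sup>2 - (norm (Q (P z) - c))\<^sup>2))"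
    if c: "c \<in> K" for z c
  proof -
    define E1 where "E1 = (norm (z - c))\<^sup>2 - (norm (P z - c))\<^sup>2"
    define E2 where "E2 = (norm (P z - c))\<^sup>2 - (norm (Q (P z) - c))\<^sup>2"
    have E: "0 \<le> E1" "0 \<le> E2"
      using strongly_fejerD(1)[OF P c] strongly_fejerD(1)[OF Q c] by (simp_all add: E1_def E2_def power_mono)
    have E12: "(norm (z - c))\<^sup>2 - (norm (Q (P z) - c))\<^sup>2 = E1 + E2"
      by (simp add: E1_def E2_def)
    have step: "(norm (P z - z))\<^sup>2 \<le> L1 * E1"
      using strongly_fejerD(2)[OF P c] by (simp add: E1_def)
    have combine: "d\<^sup>2 \<le> (L1 + L2) * (E1 + E2)"
      if "0 \<le> d" "d \<le> norm (P z - z) + b" "b\<^sup>2 \<le> L2 * E2" for b d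
    proof -
      have "d\<^sup>2 \<le> (norm (P z - z) + b)\<^sup>2"
        using that by (intro power_mono) auto
      also have "\<dots> \<le> (L1 + L2) * (E1 + E2)"
        using step that(3) nn E by (rule square_sum_le_mult_sum)
      finally show ?thesis .
    qed
    have "norm (Q (P z) - c) \<le> norm (z - c)"
      using strongly_fejerD(1)[OF P c, of z] strongly_fejerD(1)[OF Q c, of "P z"] by linarith
    moreover have "(norm (Q (P z) - z))\<^sup>2 \<le> (L1 + L2) * (E1 + E2)"
    proof (rule combine)
      show "norm (Q (P z) - z) \<le> norm (P z - z) + norm (Q (P z) - P z)"
        using norm_triangle_ineq[of "P z - z" "Q (P z) - P z"] by simp
      show "(norm (Q (P z) - P z))\<^sup>2 \<le> L2 * E2"
        using strongly_fejerD(2)[OF Q c] by (simp add: E2_def)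
    qed simp
    moreover have "(infdist z (C j))\<^sup>2 \<le> (L1 + L2) * (E1 + E2)" if "j \<in> A1" for j
    proof -
      have "(infdist z (C j))\<^sup>2 \<le> L1 * E1"
        using strongly_fejerD(3)[OF P c that] by (simp add: E1_def)
      also have "\<dots> \<le> (L1 + L2) * (E1 + E2)"
        using nn E by (intro mult_mono) auto
      finally show ?thesis .
    qed
    moreover have "(infdist z (C j))\<^sup>2 \<le> (L1 + L2) * (E1 + E2)" if "j \<in> A2" for j
    proof (rule combine)
      show "infdist z (C j) \<le> norm (P z - z) + infdist (P z) (C j)"
        using infdist_triangle[of z "C j" "P z"] by (simp add: dist_norm norm_minus_commute)
      show "(infdist (P z) (C j))\<^sup>2 \<le> L2 * E2"
        using strongly_fejerD(3)[OF Q c that] by (simp add: E2_def)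
    qed (rule infdist_nonneg)
    ultimately show ?thesis
      unfolding E12 by blast
  qed
  then show ?thesis
    using nn by (simp add: strongly_fejer_def)
qed

lemma strongly_fejer_fold:
  assumes "\<And>j. j \<in> set xs \<Longrightarrow> strongly_fejer C K L (A j) (P j)" "0 \<le> L"
  shows "strongly_fejer C K (real (length xs) * L) (\<Union>j\<in>set xs. A j) (fold P xs)"
  using assms(1)
proof (induction xs)
  case Nil
  then show ?case
    by (simp add: strongly_fejer_def)
next
  case (Cons j xs)
  then have "strongly_fejer C K (L + real (length xs) * L) (A j \<union> (\<Union>i\<in>set xs. A i)) (fold P xs \<circ> P j)"
    by (intro strongly_fejer_comp) auto
  then show ?case
    by (simp add: algebra_simps comp_def)
qed

lemma norm_convex_combination_square_le:
  fixes v :: "'i \<Rightarrow> 'a::real_inner"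
  assumes "finite F" "\<And>n. n \<in> F \<Longrightarrow> 0 \<le> w n" "sum w F = 1"
  shows "(norm (\<Sum>n\<in>F. w n *\<^sub>R v n))\<^sup>2 \<le> (\<Sum>n\<in>F. w n * (norm (v n))\<^sup>2)"
proof -
  have "norm (\<Sum>n\<in>F. w n *\<^sub>R v n) \<le> (\<Sum>n\<in>F. w n *\<^sub>R norm (v n))"
    using assms(2) by (intro sum_norm_le) auto
  then have "(norm (\<Sum>n\<in>F. w n *\<^sub>R v n))\<^sup>2 \<le> (\<Sum>n\<in>F. w n *\<^sub>R norm (v n))\<^sup>2"
    by (intro power_mono) auto
  also have "\<dots> \<le> (\<Sum>n\<in>F. w n * (norm (v n))\<^sup>2)"
    using assms by (intro convex_on_sum[OF _ _ convex_power2]) auto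
  finally show ?thesis .
qed

text \<open>Every weight is at least \<open>\<omega>\<close>, so the decrease achieved by a single operator survives in the
  average up to the factor \<open>\<omega>\<close>.\<close>

lemma strongly_fejer_average:
  fixes P :: "'n \<Rightarrow> 'a::real_inner \<Rightarrow> 'a"
  assumes P: "\<And>n. n \<in> F \<Longrightarrow> strongly_fejer C K L (A n) (P n)"
    and w: "finite F" "0 < \<omega>" "\<And>n. n \<in> F \<Longrightarrow> \<omega> \<le> w n" "sum w F = 1"
  shows "strongly_fejer C K (L / \<omega>) (\<Union>n\<in>F. A n) (\<lambda>z. \<Sum>n\<in>F. w n *\<^sub>R P n z)"
proof -
  have w0: "0 \<le> w n" if "n \<in> F" for n
    using w(2) w(3)[OF that] by linarith
  obtain n0 where n0: "n0 \<in> F" using w(4) by fastforce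
  then have "w n0 \<le> 1"
    using member_le_sum[of n0 F w] w w0 by auto
  then have "\<omega> \<le> 1" using w(3)[OF n0] by linarith
  have "0 \<le> L" using strongly_fejer_nonneg[OF P[OF n0]] .
  then have LL: "L \<le> L / \<omega>"
    using \<open>0 < \<omega>\<close> \<open>\<omega> \<le> 1\<close> by (simp add: field_simps mult_left_le)
  have "norm ((\<Sum>n\<in>F. w n *\<^sub>R P n z) - c) \<le> norm (z - c) \<and>
      (norm ((\<Sum>n\<in>F. w n *\<^sub>R P n z) - z))\<^sup>2
        \<le> L / \<omega> * ((norm (z - c))\<^sup>2 - (norm ((\<Sum>n\<in>F. w n *\<^sub>R P n z) - c))\<^sup>2) \<and>
      (\<forall>j\<in>(\<Union>n\<in>F. A n). (infdist z (C j))\<^sup>2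
        \<le> L / \<omega> * ((norm (z - c))\<^sup>2 - (norm ((\<Sum>n\<in>F. w n *\<^sub>R P n z) - c))\<^sup>2))"
    if c: "c \<in> K" for z c
  proof -
    define avg where "avg = (\<Sum>n\<in>F. w n *\<^sub>R P n z)"
    define E where "E n = (norm (z - c))\<^sup>2 - (norm (P n z - c))\<^sup>2" for n
    have E0: "0 \<le> E n" if "n \<in> F" for n
      using strongly_fejerD(1)[OF P[OF that] c] by (simp add: E_def power_mono)
    have avg_diff: "avg - y = (\<Sum>n\<in>F. w n *\<^sub>R (P n z - y))" for y
      using w(4) by (simp add: avg_def scaleR_diff_right sum_subtractf flip: scaleR_sum_left)
    have "(norm (avg - c))\<^sup>2 \<le> (\<Sum>n\<in>F. w n * (norm (P n z - c))\<^sup>2)"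
      unfolding avg_diff using w w0 by (intro norm_convex_combination_square_le) auto
    moreover have "(\<Sum>n\<in>F. w n * E n) = (norm (z - c))\<^sup>2 - (\<Sum>n\<in>F. w n * (norm (P n z - c))\<^sup>2)"
      using w(4) by (simp add: E_def right_diff_distrib sum_subtractf flip: sum_distrib_right)
    ultimately have sumE: "(\<Sum>n\<in>F. w n * E n) \<le> (norm (z - c))\<^sup>2 - (norm (avg - c))\<^sup>2"
      by linarith
    have "0 \<le> (\<Sum>n\<in>F. w n * E n)"
      using w0 E0 by (intro sum_nonneg) auto
    with sumE have ge0: "0 \<le> (norm (z - c))\<^sup>2 - (norm (avg - c))\<^sup>2" by linarith
    have "norm (avg - c) \<le> norm (z - c)"
      by (rule power2_le_imp_le) (use ge0 in auto)
    moreover have "(norm (avg - z))\<^sup>2 \<le> L / \<omega> * ((norm (z - c))\<^sup>2 - (norm (avg - c))\<^sup>2)"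
    proof -
      have "(norm (avg - z))\<^sup>2 \<le> (\<Sum>n\<in>F. w n * (norm (P n z - z))\<^sup>2)"
        unfolding avg_diff using w w0 by (intro norm_convex_combination_square_le) auto
      also have "\<dots> \<le> (\<Sum>n\<in>F. w n * (L * E n))"
        using strongly_fejerD(2)[OF P c] w0 by (intro sum_mono mult_left_mono) (auto simp: E_def)
      also have "\<dots> = L * (\<Sum>n\<in>F. w n * E n)"
        by (simp add: sum_distrib_left mult.left_commute)
      also have "\<dots> \<le> L * ((norm (z - c))\<^sup>2 - (norm (avg - c))\<^sup>2)"
        using sumE \<open>0 \<le> L\<close> by (rule mult_left_mono)
      also have "\<dots> \<le> L / \<omega> * ((norm (z - c))\<^sup>2 - (norm (avg - c))\<^sup>2)"
        using LL ge0 by (rule mult_right_mono)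
      finally show ?thesis .
    qed
    moreover have "(infdist z (C j))\<^sup>2 \<le> L / \<omega> * ((norm (z - c))\<^sup>2 - (norm (avg - c))\<^sup>2)"
      if "n \<in> F" "j \<in> A n" for j n
    proof -
      have "\<omega> * E n \<le> w n * E n"
        using w(3)[OF that(1)] E0[OF that(1)] by (rule mult_right_mono)
      also have "\<dots> \<le> (\<Sum>n\<in>F. w n * E n)"
        using that(1) w w0 E0 by (intro member_le_sum) auto
      also note sumE
      finally have *: "\<omega> * E n \<le> (norm (z - c))\<^sup>2 - (norm (avg - c))\<^sup>2" .
      have "(infdist z (C j))\<^sup>2 \<le> L * E n"
        using strongly_fejerD(3)[OF P[OF that(1)] c that(2)] by (simp add: E_def)
      also have "\<dots> = L / \<omega> * (\<omega> * E n)"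
        using \<open>0 < \<omega>\<close> by simp
      also have "\<dots> \<le> L / \<omega> * ((norm (z - c))\<^sup>2 - (norm (avg - c))\<^sup>2)"
        using * \<open>0 \<le> L\<close> \<open>0 < \<omega>\<close> by (intro mult_left_mono) auto
      finally show ?thesis .
    qed
    ultimately show ?thesis
      unfolding avg_def[symmetric] by blast
  qed
  then show ?thesis
    using \<open>0 \<le> L\<close> \<open>0 < \<omega>\<close> unfolding strongly_fejer_def by simp
qed

lemma nonexpansive_fold:
  fixes P :: "'i \<Rightarrow> 'a::real_normed_vector \<Rightarrow> 'a"
  assumes "\<And>j y z. j \<in> set xs \<Longrightarrow> norm (P j y - P j z) \<le> norm (y - z)"
  shows "norm (fold P xs y - fold P xs z) \<le> norm (y - z)"
  using assms
proof (induction xs arbitrary: y z)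
  case (Cons j xs)
  have "norm (fold P xs (P j y) - fold P xs (P j z)) \<le> norm (P j y - P j z)"
    by (rule Cons.IH) (simp add: Cons.prems)
  also have "\<dots> \<le> norm (y - z)"
    by (simp add: Cons.prems)
  finally show ?case by simp
qed simp

lemma nonexpansive_average:
  fixes P :: "'n \<Rightarrow> 'a::real_normed_vector \<Rightarrow> 'a"
  assumes "\<And>n. n \<in> F \<Longrightarrow> norm (P n y - P n z) \<le> norm (y - z)"
    and "\<And>n. n \<in> F \<Longrightarrow> 0 \<le> w n" "sum w F = 1"
  shows "norm ((\<Sum>n\<in>F. w n *\<^sub>R P n y) - (\<Sum>n\<in>F. w n *\<^sub>R P n z)) \<le> norm (y - z)"
proof -
  have "norm (\<Sum>n\<in>F. w n *\<^sub>R (P n y - P n z)) \<le> (\<Sum>n\<in>F. w n * norm (y - z))"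
    using assms(1,2) by (intro sum_norm_le) (simp add: mult_left_mono)
  then show ?thesis
    using assms(3) by (simp add: scaleR_diff_right sum_subtractf flip: sum_distrib_right)
qed

section \<open>Regularity and rates\<close>

lemma max_dist_le_iff:
  "finite I \<Longrightarrow> I \<noteq> {} \<Longrightarrow> max_dist I C x \<le> t \<longleftrightarrow> (\<forall>i\<in>I. infdist x (C i) \<le> t)"
  by (auto simp: max_dist_def)

lemma infdist_le_max_dist: "finite I \<Longrightarrow> i \<in> I \<Longrightarrow> infdist x (C i) \<le> max_dist I C x"
  by (auto simp: max_dist_def)

lemma max_dist_nonneg: "finite I \<Longrightarrow> I \<noteq> {} \<Longrightarrow> 0 \<le> max_dist I C x"
  by (metis all_not_in_conv infdist_le_max_dist infdist_nonneg order_trans)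

lemma max_dist_triangle:
  assumes "finite I" "I \<noteq> {}"
  shows "max_dist I C x \<le> max_dist I C y + dist x y"
  unfolding max_dist_le_iff[OF assms]
proof
  fix i assume "i \<in> I"
  then show "infdist x (C i) \<le> max_dist I C y + dist x y"
    using infdist_triangle[of x "C i" y] infdist_le_max_dist[OF assms(1), of i y C] by linarith
qed

lemma max_dist_le_infdist_Inter:
  assumes "finite I" "I \<noteq> {}" "(\<Inter>i\<in>I. C i) \<noteq> {}"
  shows "max_dist I C x \<le> infdist x (\<Inter>i\<in>I. C i)"
  unfolding max_dist_le_iff[OF assms(1,2)] by (intro ballI infdist_mono INT_lower assms(3))

lemma max_dist_tendsto_0:
  assumes "finite I" "I \<noteq> {}" and lim: "\<And>i. i \<in> I \<Longrightarrow> (\<lambda>n. infdist (Y n) (C i)) \<longlonglongrightarrow> 0"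
  shows "(\<lambda>n. max_dist I C (Y n)) \<longlonglongrightarrow> 0"
proof (rule tendsto_sandwich[OF _ _ tendsto_const])
  show "(\<lambda>n. \<Sum>i\<in>I. infdist (Y n) (C i)) \<longlonglongrightarrow> 0"
    using tendsto_sum[OF lim] by simp
  have "max_dist I C (Y n) \<le> (\<Sum>i\<in>I. infdist (Y n) (C i))" for n
    unfolding max_dist_le_iff[OF assms(1,2)]
    by (intro ballI member_le_sum infdist_nonneg assms(1))
  then show "\<forall>\<^sub>F n in sequentially. max_dist I C (Y n) \<le> (\<Sum>i\<in>I. infdist (Y n) (C i))"
    by simp
qed (simp add: max_dist_nonneg assms(1,2))

text \<open>Contraction by the factor \<open>r\<close> over every window of \<open>s\<close> steps is geometric decay with ratio
  \<open>root s r\<close>; the factor \<open>1 / r\<close> pays for the last, incomplete window.\<close>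

lemma geometric_decay_from_window:
  fixes d :: "nat \<Rightarrow> real"
  assumes dec: "decseq d" and window: "\<And>n. d (n + s) \<le> r * d n"
    and r: "0 < r" "r < 1" and s: "s \<ge> 1" and "0 \<le> d 0"
  shows "d n \<le> d 0 / r * root s r ^ n"
proof -
  have blocks: "d (s * k) \<le> r ^ k * d 0" for k
  proof (induction k)
    case (Suc k)
    have "d (s * Suc k) \<le> r * d (s * k)"
      using window[of "s * k"] by (simp add: add.commute)
    also have "\<dots> \<le> r * (r ^ k * d 0)"
      using Suc r by (intro mult_left_mono) auto
    finally show ?case by simp
  qed simp
  define q where "q = root s r"
  have q: "q ^ s = r" "0 \<le> q" "q \<le> 1"
    using r s by (auto simp: q_def real_root_pow_pos)
  have n: "n \<le> s * Suc (n div s)"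
    using dividend_less_times_div[of s n] s by simp
  have "r ^ (n div s) * r = q ^ (s * Suc (n div s))"
    unfolding power_mult q(1) by simp
  also have "\<dots> \<le> q ^ n"
    using q n by (intro power_decreasing) auto
  finally have *: "r ^ (n div s) \<le> q ^ n / r"
    using r by (simp add: field_simps)
  have "d n \<le> d (s * (n div s))"
    using dec by (auto simp: decseq_def)
  also have "\<dots> \<le> r ^ (n div s) * d 0" by (rule blocks)
  also have "\<dots> \<le> q ^ n / r * d 0"
    using * \<open>0 \<le> d 0\<close> by (rule mult_right_mono)
  finally show ?thesis by (simp add: q_def mult.commute)
qed

section \<open>Exact and inexact orbits\<close>

text \<open>The exact orbit started at time \<open>i\<close> in \<open>z\<close>: its \<open>n\<close>-th term is $T_{i+n-1} \cdots T_i z$, so that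
  \<open>orbit T i z 0 = z\<close>.\<close>

definition orbit :: "(nat \<Rightarrow> 'a \<Rightarrow> 'a) \<Rightarrow> nat \<Rightarrow> 'a \<Rightarrow> nat \<Rightarrow> 'a" where
  "orbit T i z n = fold T [i..<i + n] z"

lemma orbit_0 [simp]: "orbit T i z 0 = z"
  by (simp add: orbit_def)

lemma orbit_Suc: "orbit T i z (Suc n) = T (i + n) (orbit T i z n)"
  by (simp add: orbit_def)

lemma orbit_add: "orbit T i z (m + n) = fold T [i + m..<i + m + n] (orbit T i z m)"
  by (simp add: orbit_def upt_add_eq_append[of i "i + m"] add.assoc[symmetric])

lemma iterate_eq_orbit: "i \<le> Suc k \<Longrightarrow> iterate T i k z = orbit T i z (Suc k - i)"
  by (simp add: iterate_def orbit_def)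

lemma iterate_offset_eq_orbit: "iterate T i (k + i) z = orbit T i z (Suc k)"
  by (simp add: iterate_eq_orbit)

context
  fixes C :: "nat \<Rightarrow> 'a::{real_inner,complete_space} set" and I :: "nat set" and K :: "'a set"
    and T :: "nat \<Rightarrow> 'a \<Rightarrow> 'a" and Ik :: "nat \<Rightarrow> nat set" and B :: real and s :: nat
  assumes I: "finite I" "I \<noteq> {}"
    and K_def: "K = (\<Inter>i\<in>I. C i)" and K_ne: "K \<noteq> {}"
    and closed_C: "\<And>i. i \<in> I \<Longrightarrow> closed (C i)" and convex_C: "\<And>i. i \<in> I \<Longrightarrow> convex (C i)"
    and T_fejer: "\<And>k. strongly_fejer C K B (Ik k) (T k)"
    and T_nonexp: "\<And>k y z. norm (T k y - T k z) \<le> norm (y - z)"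
    and cover: "\<And>k. I \<subseteq> (\<Union>l\<in>{k..<k + s}. Ik l)" and s: "s \<ge> 1"
begin

lemma common_set_closed_convex: "closed K" "convex K" "K \<noteq> {}"
  unfolding K_def using closed_C convex_C K_ne[unfolded K_def]
  by (blast intro: closed_INT, blast intro: convex_INT, simp)

lemma orbit_fejer: "c \<in> K \<Longrightarrow> norm (orbit T i z (Suc n) - c) \<le> norm (orbit T i z n - c)"
  unfolding orbit_Suc by (rule strongly_fejerD(1)[OF T_fejer])

text \<open>Every index is active at least once in a window of \<open>s\<close> consecutive steps, so the decrease of the
  squared distance to \<open>c\<close> over the window controls all the distances to the sets \<open>C j\<close>.\<close>

lemma orbit_window:
  assumes "c \<in> K" "j \<in> I"
  shows "(infdist (orbit T i z n) (C j))\<^sup>2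
    \<le> (s * B) * ((norm (orbit T i z n - c))\<^sup>2 - (norm (orbit T i z (n + s) - c))\<^sup>2)"
proof -
  have "strongly_fejer C K (real (length [i + n..<i + n + s]) * B)
      (\<Union>l\<in>set [i + n..<i + n + s]. Ik l) (fold T [i + n..<i + n + s])"
    by (intro strongly_fejer_fold T_fejer strongly_fejer_nonneg[OF T_fejer])
  then have "strongly_fejer C K (s * B) (\<Union>l\<in>{i + n..<i + n + s}. Ik l) (fold T [i + n..<i + n + s])"
    by simp
  from strongly_fejerD(3)[OF this assms(1) subsetD[OF cover assms(2)]]
  show ?thesis
    unfolding orbit_add[of T i z n s] .
qed

lemma orbit_infdist_tendsto_0:
  assumes "j \<in> I"
  shows "(\<lambda>n. infdist (orbit T i z n) (C j)) \<longlonglongrightarrow> 0"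
proof -
  obtain c where c: "c \<in> K" using K_ne by blast
  obtain l where l: "(\<lambda>n. (norm (orbit T i z n - c))\<^sup>2) \<longlonglongrightarrow> l"
    using fejer_norm_diff_convergent[of K "orbit T i z", OF common_set_closed_convex orbit_fejer c] unfolding convergent_def ..
  have "(\<lambda>n. (s * B) * ((norm (orbit T i z n - c))\<^sup>2 - (norm (orbit T i z (n + s) - c))\<^sup>2))
      \<longlonglongrightarrow> (s * B) * (l - l)"
    by (intro tendsto_intros l LIMSEQ_ignore_initial_segment[OF l])
  then have "(\<lambda>n. (s * B) * ((norm (orbit T i z n - c))\<^sup>2 - (norm (orbit T i z (n + s) - c))\<^sup>2))
      \<longlonglongrightarrow> 0"
    by simp
  then have "(\<lambda>n. (infdist (orbit T i z n) (C j))\<^sup>2) \<longlonglongrightarrow> 0"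
    by (rule tendsto_sandwich[OF always_eventually always_eventually tendsto_const, rotated 2])
      (simp, intro allI orbit_window c assms)
  then have "(\<lambda>n. sqrt ((infdist (orbit T i z n) (C j))\<^sup>2)) \<longlonglongrightarrow> sqrt 0"
    by (rule tendsto_real_sqrt)
  then show ?thesis by (simp add: infdist_nonneg)
qed

lemma orbit_weak_limit:
  assumes "(\<lambda>n. metric_proj K (orbit T i z n)) \<longlonglongrightarrow> p"
  shows "weakly_converges (orbit T i z) p"
  using fejer_weak_limit[of K "orbit T i z", OF common_set_closed_convex orbit_fejer assms K_def closed_C convex_C
      orbit_infdist_tendsto_0] .

lemma orbit_strong_limit:
  assumes reg: "boundedly_regular I C"
    and p: "(\<lambda>n. metric_proj K (orbit T i z n)) \<longlonglongrightarrow> p"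
  shows "orbit T i z \<longlonglongrightarrow> p"
proof -
  obtain c where c: "c \<in> K" using K_ne by blast
  have "bounded (range (orbit T i z))"
  proof (rule boundedI)
    fix y assume "y \<in> range (orbit T i z)"
    then obtain n where n: "y = orbit T i z n" by blast
    have "norm (y - c) \<le> norm (z - c)"
      using fejer_mono[of K "orbit T i z", OF common_set_closed_convex orbit_fejer c, of 0 n] n by simp
    then show "norm y \<le> norm (z - c) + norm c"
      using norm_triangle_ineq[of "y - c" c] by simp
  qed
  then have "regular_over I C (range (orbit T i z))"
    using reg by (simp add: boundedly_regular_def)
  moreover have "(\<lambda>n. max_dist I C (orbit T i z n)) \<longlonglongrightarrow> 0"
    by (intro max_dist_tendsto_0 I orbit_infdist_tendsto_0)
  ultimately have "(\<lambda>n. infdist (orbit T i z n) K) \<longlonglongrightarrow> 0"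
    by (simp add: regular_over_def K_def)
  then have "(\<lambda>n. 2 * infdist (orbit T i z n) K) \<longlonglongrightarrow> 0"
    by (rule tendsto_mult_right_zero)
  then have "(\<lambda>n. norm (orbit T i z n - p)) \<longlonglongrightarrow> 0"
    by (rule tendsto_sandwich[OF always_eventually always_eventually tendsto_const, rotated 2])
      (simp, intro allI fejer_dist_limit[of K "orbit T i z", OF common_set_closed_convex orbit_fejer p])
  then show ?thesis
    by (simp add: LIM_zero_iff tendsto_norm_zero_iff)
qed

text \<open>With \<open>c\<close> the projection of the current point onto \<open>K\<close>, linear regularity turns the window
  estimate into a contraction of the squared distance to \<open>K\<close> with the factor \<open>1 - 1 / A\<close>, for any
  positive \<open>A \<ge> \<kappa>\<^sup>2 * (s * B)\<close>. The summand \<open>2\<close> in the definition of \<open>r\<close> ensures \<open>A > 1\<close>, and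
  thereby \<open>0 < r\<close>.\<close>

lemma orbit_linear_rate:
  assumes "\<kappa> > 0" and reg: "\<And>n. infdist (orbit T i z n) K \<le> \<kappa> * max_dist I C (orbit T i z n)"
    and r: "r = sqrt (1 - 1 / (\<kappa>\<^sup>2 * (s * B) + 2))"
  shows "infdist (orbit T i z n) K \<le> infdist z K / r * root s r ^ n"
proof -
  define A where "A = \<kappa>\<^sup>2 * (s * B) + 2"
  have "0 \<le> B" by (rule strongly_fejer_nonneg[OF T_fejer])
  then have A: "2 \<le> A" by (simp add: A_def)
  let ?d = "\<lambda>n. infdist (orbit T i z n) K"
  have sq: "(?d (n + s))\<^sup>2 \<le> (1 - 1 / A) * (?d n)\<^sup>2" for n
  proof -
    define c where "c = metric_proj K (orbit T i z n)"
    have c: "c \<in> K" unfolding c_def by (rule metric_proj_in[OF common_set_closed_convex])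
    have dn: "norm (orbit T i z n - c) = ?d n"
      unfolding c_def by (rule norm_metric_proj[OF common_set_closed_convex])
    have dns: "?d (n + s) \<le> norm (orbit T i z (n + s) - c)"
      using infdist_le[OF c] by (simp add: dist_norm)
    obtain j where j: "j \<in> I" "max_dist I C (orbit T i z n) = infdist (orbit T i z n) (C j)"
      using Max_in[of "(\<lambda>j. infdist (orbit T i z n) (C j)) ` I"] I
      by (auto simp: max_dist_def image_iff)
    have "(?d n)\<^sup>2 \<le> (\<kappa> * infdist (orbit T i z n) (C j))\<^sup>2"
      using reg[of n] by (intro power_mono infdist_nonneg) (simp add: j(2))
    also have "\<dots> = \<kappa>\<^sup>2 * (infdist (orbit T i z n) (C j))\<^sup>2"
      by (simp add: power_mult_distrib)
    also have "\<dots> \<le> \<kappa>\<^sup>2 * ((s * B) * ((?d n)\<^sup>2 - (norm (orbit T i z (n + s) - c))\<^sup>2))"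
      using orbit_window[OF c j(1), of i z n] by (intro mult_left_mono) (simp_all add: dn)
    also have "\<dots> \<le> \<kappa>\<^sup>2 * ((s * B) * ((?d n)\<^sup>2 - (?d (n + s))\<^sup>2))"
      using dns \<open>0 \<le> B\<close> by (intro mult_left_mono diff_left_mono power_mono infdist_nonneg) auto
    also have "\<dots> = (A - 2) * ((?d n)\<^sup>2 - (?d (n + s))\<^sup>2)"
      by (simp add: A_def)
    also have "\<dots> \<le> A * ((?d n)\<^sup>2 - (?d (n + s))\<^sup>2)"
      using fejer_infdist_mono[of K "orbit T i z", OF common_set_closed_convex orbit_fejer, of n "n + s"]
      by (intro mult_right_mono) (simp_all add: power_mono infdist_nonneg)
    finally show ?thesis
      using A by (simp add: field_simps)
  qed
  have r2: "r\<^sup>2 = 1 - 1 / A" and r01: "0 < r" "r < 1"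
    using A by (simp_all add: r flip: A_def)
  have "?d n \<le> ?d 0 / r * root s r ^ n"
  proof (rule geometric_decay_from_window)
    show "decseq ?d"
      using fejer_infdist_mono[of K "orbit T i z", OF common_set_closed_convex orbit_fejer] by (simp add: decseq_def)
    show "?d (n + s) \<le> r * ?d n" for n
    proof (rule power2_le_imp_le)
      show "(?d (n + s))\<^sup>2 \<le> (r * ?d n)\<^sup>2"
        using sq[of n] by (simp add: power_mult_distrib r2)
      show "0 \<le> r * ?d n"
        using r01 by (simp add: infdist_nonneg)
    qed
  qed (use r01 s infdist_nonneg in auto)
  then show ?thesis by simp
qed

context
  fixes x :: "nat \<Rightarrow> 'a" and e :: "nat \<Rightarrow> real"
  assumes e_nonneg: "\<And>k. 0 \<le> e k" and e_summable: "summable e"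
    and inexact: "\<And>k. norm (x (Suc k) - T k (x k)) \<le> e k"
begin

lemma tail_sum_le: "(\<Sum>j<n. e (i + j)) \<le> (\<Sum>j. e (i + j))"
  using e_summable by (intro sum_le_suminf) (auto simp: e_nonneg summable_iff_shift add.commute[of i])

lemma tail_nonneg: "0 \<le> (\<Sum>j. e (i + j))"
  using tail_sum_le[where n = 0] by simp

lemma tail_antimono: "i \<le> k \<Longrightarrow> (\<Sum>j. e (k + j)) \<le> (\<Sum>j. e (i + j))"
proof -
  assume "i \<le> k"
  then have "sum e {..<i} \<le> sum e {..<k}"
    by (intro sum_mono2) (auto simp: e_nonneg)
  then show ?thesis
    using suminf_minus_initial_segment[OF e_summable, of i]
      suminf_minus_initial_segment[OF e_summable, of k]
    by (simp add: add.commute)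
qed

lemma tail_tendsto_0: "(\<lambda>i. \<Sum>j. e (i + j)) \<longlonglongrightarrow> 0"
proof -
  have "(\<lambda>i. (\<Sum>j. e j) - sum e {..<i}) \<longlonglongrightarrow> (\<Sum>j. e j) - (\<Sum>j. e j)"
    by (intro tendsto_intros summable_LIMSEQ e_summable)
  then show ?thesis
    using suminf_minus_initial_segment[OF e_summable] by (simp add: add.commute)
qed

lemma inexact_orbit_deviation: "norm (x (i + n) - orbit T i (x i) n) \<le> (\<Sum>j. e (i + j))"
proof -
  have "norm (x (i + n) - orbit T i (x i) n) \<le> (\<Sum>j<n. e (i + j))"
  proof (induction n)
    case (Suc n)
    have "norm (x (i + Suc n) - orbit T i (x i) (Suc n))
        \<le> norm (x (Suc (i + n)) - T (i + n) (x (i + n)))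
          + norm (T (i + n) (x (i + n)) - T (i + n) (orbit T i (x i) n))"
      unfolding orbit_Suc
      using norm_triangle_ineq[of "x (Suc (i + n)) - T (i + n) (x (i + n))"
          "T (i + n) (x (i + n)) - T (i + n) (orbit T i (x i) n)"] by simp
    also have "\<dots> \<le> e (i + n) + (\<Sum>j<n. e (i + j))"
      using inexact[of "i + n"] T_nonexp[of "i + n" "x (i + n)" "orbit T i (x i) n"] Suc.IH by linarith
    finally show ?case by simp
  qed simp
  then show ?thesis
    using tail_sum_le order_trans by blast
qed

lemma inexact_orbit_deviation_iterate:
  "i \<le> k \<Longrightarrow> norm (x (Suc k) - iterate T i k (x i)) \<le> (\<Sum>j. e (i + j))"
  using inexact_orbit_deviation[of i "Suc k - i"] by (simp add: iterate_eq_orbit)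

text \<open>Here \<open>p i\<close> is the limit of the exact orbit restarted from \<open>x i\<close>, obtained as the norm limit of
  its projections onto \<open>K\<close>. Since the projection and all \<open>T k\<close> are nonexpansive, \<open>p (i + m)\<close> and \<open>p i\<close>
  differ by at most the total error committed from time \<open>i\<close> on.\<close>

lemma orbit_limits:
  obtains p x_inf where "\<And>i. (\<lambda>n. metric_proj K (orbit T i (x i) n)) \<longlonglongrightarrow> p i"
    and "\<And>i. p i \<in> K" "x_inf \<in> K" "p \<longlonglongrightarrow> x_inf"
    and "\<And>i. norm (p i - x_inf) \<le> (\<Sum>j. e (i + j))"
proof -
  define p where "p i = lim (\<lambda>n. metric_proj K (orbit T i (x i) n))" for i
  have p: "(\<lambda>n. metric_proj K (orbit T i (x i) n)) \<longlonglongrightarrow> p i" for i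
    unfolding p_def using fejer_proj_convergent[of K "orbit T i (x i)", OF common_set_closed_convex orbit_fejer]
    by (simp add: convergent_LIMSEQ_iff)
  have pK: "p i \<in> K" for i
    using closed_sequentially[OF common_set_closed_convex(1) _ p] metric_proj_in[OF common_set_closed_convex] by blast
  have diff: "norm (p (i + m) - p i) \<le> (\<Sum>j. e (i + j))" for i m
  proof (rule LIMSEQ_le_const2)
    have "(\<lambda>n. metric_proj K (orbit T i (x i) (n + m))) \<longlonglongrightarrow> p i"
      by (rule LIMSEQ_ignore_initial_segment[OF p])
    then show "(\<lambda>n. norm (metric_proj K (orbit T (i + m) (x (i + m)) n)
        - metric_proj K (orbit T i (x i) (n + m)))) \<longlonglongrightarrow> norm (p (i + m) - p i)"
      by (intro tendsto_intros p)
    have "norm (metric_proj K (orbit T (i + m) (x (i + m)) n) - metric_proj K (orbit T i (x i) (n + m)))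
        \<le> (\<Sum>j. e (i + j))" for n
    proof -
      have "norm (metric_proj K (orbit T (i + m) (x (i + m)) n) - metric_proj K (orbit T i (x i) (n + m)))
          \<le> norm (orbit T (i + m) (x (i + m)) n - orbit T i (x i) (n + m))"
        by (rule metric_proj_nonexpansive[OF common_set_closed_convex])
      also have "\<dots> = norm (fold T [i + m..<i + m + n] (x (i + m))
          - fold T [i + m..<i + m + n] (orbit T i (x i) m))"
        by (simp add: orbit_add add.commute[of n m]) (simp add: orbit_def)
      also have "\<dots> \<le> norm (x (i + m) - orbit T i (x i) m)"
        by (rule nonexpansive_fold) (rule T_nonexp)
      also have "\<dots> \<le> (\<Sum>j. e (i + j))"
        by (rule inexact_orbit_deviation)
      finally show ?thesis .
    qed
    then show "\<exists>N. \<forall>n\<ge>N. norm (metric_proj K (orbit T (i + m) (x (i + m)) n)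
        - metric_proj K (orbit T i (x i) (n + m))) \<le> (\<Sum>j. e (i + j))"
      by blast
  qed
  have "Cauchy p"
  proof (rule metric_CauchyI)
    fix \<epsilon> :: real assume "\<epsilon> > 0"
    then have "\<forall>\<^sub>F i in sequentially. (\<Sum>j. e (i + j)) < \<epsilon> / 2"
      by (intro order_tendstoD(2)[OF tail_tendsto_0]) simp
    then obtain N where N: "(\<Sum>j. e (N + j)) < \<epsilon> / 2"
      by (auto simp: eventually_sequentially)
    have "dist (p m) (p N) < \<epsilon> / 2" if "N \<le> m" for m
      using diff[of N "m - N"] N that by (simp add: dist_norm)
    then have "dist (p m) (p n) < \<epsilon>" if "N \<le> m" "N \<le> n" for m n
      using that dist_triangle_half_l by blast
    then show "\<exists>N. \<forall>m\<ge>N. \<forall>n\<ge>N. dist (p m) (p n) < \<epsilon>" by blast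
  qed
  then obtain x_inf where x_inf: "p \<longlonglongrightarrow> x_inf"
    using Cauchy_convergent convergent_def by blast
  have "norm (p i - x_inf) \<le> (\<Sum>j. e (i + j))" for i
  proof (rule LIMSEQ_le_const2)
    show "(\<lambda>m. norm (p i - p (m + i))) \<longlonglongrightarrow> norm (p i - x_inf)"
      by (intro tendsto_intros LIMSEQ_ignore_initial_segment[OF x_inf])
    have "norm (p i - p (m + i)) \<le> (\<Sum>j. e (i + j))" for m
      using diff[of i m] by (simp add: norm_minus_commute add.commute)
    then show "\<exists>N. \<forall>m\<ge>N. norm (p i - p (m + i)) \<le> (\<Sum>j. e (i + j))" by blast
  qed
  moreover have "x_inf \<in> K"
    using closed_sequentially[OF common_set_closed_convex(1) _ x_inf] pK by blast
  ultimately show ?thesis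
    using that p pK x_inf by blast
qed

lemma inexact_orbit_bounded:
  assumes "c \<in> K"
  shows "norm (x i - c) \<le> norm (x 0 - c) + (\<Sum>j. e j)"
    and "norm (orbit T i (x i) n - c) \<le> norm (x 0 - c) + (\<Sum>j. e j)"
proof -
  have mono: "norm (orbit T i z n - c) \<le> norm (z - c)" for i z n
    using fejer_mono[of K "orbit T i z", OF common_set_closed_convex orbit_fejer assms, of 0 n] by simp
  show "norm (x i - c) \<le> norm (x 0 - c) + (\<Sum>j. e j)"
    using inexact_orbit_deviation[of 0 i] mono[of 0 "x 0" i]
      norm_triangle_ineq[of "x i - orbit T 0 (x 0) i" "orbit T 0 (x 0) i - c"] by simp
  then show "norm (orbit T i (x i) n - c) \<le> norm (x 0 - c) + (\<Sum>j. e j)"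
    using mono[of i "x i" n] by linarith
qed

lemma inexact_orbit_weak:
  "\<exists>x_inf \<in> K. \<exists>xi_inf :: nat \<Rightarrow> 'a.
     (\<forall>i. xi_inf i \<in> K) \<and>
     (\<forall>i. weakly_converges (\<lambda>k. iterate T i k (x i)) (xi_inf i)) \<and>
     xi_inf \<longlonglongrightarrow> x_inf \<and>
     (\<forall>y k i. i \<le> k \<longrightarrow>
        \<bar>inner y (x (Suc k) - x_inf)\<bar>
          \<le> \<bar>inner y (iterate T i k (x i) - xi_inf i)\<bar> + 2 * norm y * (\<Sum>j. e (i + j)))"
proof (rule orbit_limits)
  fix p x_inf
  assume p: "\<And>i. (\<lambda>n. metric_proj K (orbit T i (x i) n)) \<longlonglongrightarrow> p i" and pK: "\<And>i. p i \<in> K"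
    and x_inf: "x_inf \<in> K" "p \<longlonglongrightarrow> x_inf"
    and tail: "\<And>i. norm (p i - x_inf) \<le> (\<Sum>j. e (i + j))"
  have weak: "weakly_converges (\<lambda>k. iterate T i k (x i)) (p i)" for i
    unfolding weakly_converges_def
  proof
    fix y
    have "(\<lambda>n. inner y (orbit T i (x i) n)) \<longlonglongrightarrow> inner y (p i)"
      using orbit_weak_limit[OF p, of i] by (simp add: weakly_converges_def)
    then have "(\<lambda>k. inner y (iterate T i (k + i) (x i))) \<longlonglongrightarrow> inner y (p i)"
      unfolding iterate_offset_eq_orbit by (rule LIMSEQ_Suc)
    then show "(\<lambda>k. inner y (iterate T i k (x i))) \<longlonglongrightarrow> inner y (p i)"
      by (rule LIMSEQ_offset)
  qed
  have "\<bar>inner y (x (Suc k) - x_inf)\<bar>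
      \<le> \<bar>inner y (iterate T i k (x i) - p i)\<bar> + 2 * norm y * (\<Sum>j. e (i + j))" if "i \<le> k" for y k i
  proof -
    have "inner y (x (Suc k) - x_inf) = inner y (x (Suc k) - iterate T i k (x i))
        + inner y (iterate T i k (x i) - p i) + inner y (p i - x_inf)"
      by (simp add: inner_diff_right)
    moreover have "\<bar>inner y (x (Suc k) - iterate T i k (x i))\<bar> \<le> norm y * (\<Sum>j. e (i + j))"
      using Cauchy_Schwarz_ineq2 mult_left_mono[OF inexact_orbit_deviation_iterate[OF that] norm_ge_zero]
        order_trans by blast
    moreover have "\<bar>inner y (p i - x_inf)\<bar> \<le> norm y * (\<Sum>j. e (i + j))"
      using Cauchy_Schwarz_ineq2 mult_left_mono[OF tail norm_ge_zero] order_trans by blast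
    ultimately show ?thesis by linarith
  qed
  with pK x_inf weak show ?thesis by blast
qed

lemma inexact_orbit_strong:
  assumes "boundedly_regular I C"
  shows "\<exists>x_inf \<in> K. \<exists>xi_inf :: nat \<Rightarrow> 'a.
     (\<forall>i. xi_inf i \<in> K) \<and>
     (\<forall>i. (\<lambda>k. iterate T i k (x i)) \<longlonglongrightarrow> xi_inf i) \<and>
     xi_inf \<longlonglongrightarrow> x_inf \<and>
     (\<forall>k i. i \<le> k \<longrightarrow>
        norm (x (Suc k) - x_inf)
          \<le> norm (iterate T i k (x i) - xi_inf i) + 2 * (\<Sum>j. e (i + j)))"
proof (rule orbit_limits)
  fix p x_inf
  assume p: "\<And>i. (\<lambda>n. metric_proj K (orbit T i (x i) n)) \<longlonglongrightarrow> p i" and pK: "\<And>i. p i \<in> K"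
    and x_inf: "x_inf \<in> K" "p \<longlonglongrightarrow> x_inf"
    and tail: "\<And>i. norm (p i - x_inf) \<le> (\<Sum>j. e (i + j))"
  have strong: "(\<lambda>k. iterate T i k (x i)) \<longlonglongrightarrow> p i" for i
  proof -
    have "(\<lambda>k. iterate T i (k + i) (x i)) \<longlonglongrightarrow> p i"
      unfolding iterate_offset_eq_orbit by (rule LIMSEQ_Suc[OF orbit_strong_limit[OF assms p]])
    then show ?thesis by (rule LIMSEQ_offset)
  qed
  have "norm (x (Suc k) - x_inf) \<le> norm (iterate T i k (x i) - p i) + 2 * (\<Sum>j. e (i + j))"
    if "i \<le> k" for k i
    using inexact_orbit_deviation_iterate[OF that] tail[of i]
      norm_triangle_ineq[of "x (Suc k) - iterate T i k (x i)" "iterate T i k (x i) - p i"]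
      norm_triangle_ineq[of "x (Suc k) - p i" "p i - x_inf"]
    by simp
  with pK x_inf strong show ?thesis by blast
qed

lemma inexact_orbit_linear:
  assumes reg: "boundedly_linearly_regular I C"
  shows "\<exists>\<kappa> c q :: real. \<exists>x_inf \<in> K.
     \<kappa> > 0 \<and> c > 0 \<and> 0 < q \<and> q < 1 \<and>
     (\<forall>k i. i \<le> k \<longrightarrow>
        1 / (2 * \<kappa>) * norm (x (Suc k) - x_inf) - 2 * (\<Sum>j. e (i + j)) \<le> max_dist I C (x (Suc k)) \<and>
        max_dist I C (x (Suc k)) \<le> c * q ^ (k - i) + 2 * (\<Sum>j. e (i + j)))"
proof (rule orbit_limits)
  fix p x_inf
  assume p: "\<And>i. (\<lambda>n. metric_proj K (orbit T i (x i) n)) \<longlonglongrightarrow> p i" and pK: "\<And>i. p i \<in> K"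
    and x_inf: "x_inf \<in> K" "p \<longlonglongrightarrow> x_inf"
    and tail: "\<And>i. norm (p i - x_inf) \<le> (\<Sum>j. e (i + j))"
  obtain c0 where c0: "c0 \<in> K" using K_ne by blast
  define R where "R = norm (x 0 - c0) + (\<Sum>j. e j)"
  have "0 \<le> R" using tail_nonneg[of 0] by (simp add: R_def)
  obtain \<kappa>0 where \<kappa>0: "linearly_regular_over I C \<kappa>0 (cball c0 R)"
    using reg bounded_cball unfolding boundedly_linearly_regular_def by blast
  \<comment> \<open>The lower estimate needs \<open>1 \<le> 4 * \<kappa>\<close>, to absorb the error term.\<close>
  define \<kappa> where "\<kappa> = max \<kappa>0 1"
  have "\<kappa> \<ge> 1" by (simp add: \<kappa>_def)
  have lin: "infdist y K \<le> \<kappa> * max_dist I C y" if "norm (y - c0) \<le> R" for y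
  proof -
    have "infdist y K \<le> \<kappa>0 * max_dist I C y"
      using \<kappa>0 that by (simp add: linearly_regular_over_def K_def dist_norm norm_minus_commute)
    also have "\<dots> \<le> \<kappa> * max_dist I C y"
      using max_dist_nonneg[OF I] by (intro mult_right_mono) (auto simp: \<kappa>_def)
    finally show ?thesis .
  qed
  define r where "r = sqrt (1 - 1 / (\<kappa>\<^sup>2 * (s * B) + 2))"
  have "0 \<le> \<kappa>\<^sup>2 * (s * B)"
    using strongly_fejer_nonneg[OF T_fejer] by simp
  then have r: "0 < r" "r < 1"
    by (simp_all add: r_def)
  define q where "q = root s r"
  have q: "0 < q" "q < 1"
    using r s by (simp_all add: q_def)
  define c where "c = R / r + 1"
  have "0 < c" using \<open>0 \<le> R\<close> r by (simp add: c_def add_nonneg_pos)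
  have lower: "1 / (2 * \<kappa>) * norm (x (Suc k) - x_inf) - 2 * (\<Sum>j. e (i + j)) \<le> max_dist I C (x (Suc k))"
    if "i \<le> k" for k i
  proof -
    \<comment> \<open>The orbit restarted at time \<open>Suc k\<close> has initial point \<open>x (Suc k)\<close> and limit \<open>p (Suc k)\<close>.\<close>
    have "norm (x (Suc k) - p (Suc k)) \<le> 2 * infdist (x (Suc k)) K"
      using fejer_dist_limit[of K "orbit T (Suc k) (x (Suc k))", OF common_set_closed_convex orbit_fejer p, of 0] by simp
    also have "\<dots> \<le> 2 * \<kappa> * max_dist I C (x (Suc k))"
      using lin[of "x (Suc k)"] inexact_orbit_bounded(1)[OF c0] by (simp add: R_def)
    finally have "norm (x (Suc k) - x_inf) \<le> 2 * \<kappa> * max_dist I C (x (Suc k)) + (\<Sum>j. e (Suc k + j))"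
      using tail[of "Suc k"] norm_triangle_ineq[of "x (Suc k) - p (Suc k)" "p (Suc k) - x_inf"] by simp
    also have "\<dots> \<le> 2 * \<kappa> * max_dist I C (x (Suc k)) + (\<Sum>j. e (i + j))"
      using tail_antimono[of i "Suc k"] that by simp
    also have "\<dots> \<le> 2 * \<kappa> * max_dist I C (x (Suc k)) + 4 * \<kappa> * (\<Sum>j. e (i + j))"
      using tail_nonneg[of i] \<open>\<kappa> \<ge> 1\<close> mult_right_mono[of 1 "4 * \<kappa>" "\<Sum>j. e (i + j)"] by simp
    finally show ?thesis
      using \<open>\<kappa> \<ge> 1\<close> by (simp add: field_simps)
  qed
  have upper: "max_dist I C (x (Suc k)) \<le> c * q ^ (k - i) + 2 * (\<Sum>j. e (i + j))"
    if "i \<le> k" for k i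
  proof -
    let ?Y = "orbit T i (x i)" and ?n = "Suc k - i"
    have "max_dist I C (?Y ?n) \<le> infdist (?Y ?n) K"
      using max_dist_le_infdist_Inter[OF I, of C] K_ne by (simp add: K_def)
    also have "\<dots> \<le> infdist (x i) K / r * q ^ ?n"
      unfolding q_def
    proof (rule orbit_linear_rate)
      show "infdist (?Y n) K \<le> \<kappa> * max_dist I C (?Y n)" for n
        using lin inexact_orbit_bounded(2)[OF c0] by (simp add: R_def)
    qed (use \<open>\<kappa> \<ge> 1\<close> r_def in auto)
    also have "\<dots> \<le> c * q ^ (k - i)"
    proof (rule mult_mono)
      have "infdist (x i) K \<le> R"
        using infdist_le[OF c0, of "x i"] inexact_orbit_bounded(1)[OF c0, of i]
        by (simp add: R_def dist_norm)
      then have "infdist (x i) K / r \<le> R / r"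
        using r by (simp add: divide_right_mono)
      then show "infdist (x i) K / r \<le> c"
        by (simp add: c_def)
      show "q ^ ?n \<le> q ^ (k - i)"
        using q by (intro power_decreasing) auto
    qed (use \<open>0 < c\<close> q in auto)
    finally have "max_dist I C (?Y ?n) \<le> c * q ^ (k - i)" .
    moreover have "dist (x (Suc k)) (?Y ?n) \<le> (\<Sum>j. e (i + j))"
      using inexact_orbit_deviation[of i ?n] that by (simp add: dist_norm)
    ultimately show ?thesis
      using max_dist_triangle[OF I, of C "x (Suc k)" "?Y ?n"] tail_nonneg[of i] by linarith
  qed
  show ?thesis
    using \<open>\<kappa> \<ge> 1\<close> \<open>0 < c\<close> q lower upper x_inf(1)
    by (intro exI[of _ \<kappa>] exI[of _ c] exI[of _ q] bexI[of _ x_inf]) auto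
qed

end

end

section \<open>The dynamic string averaging projection method\<close>

theorem theorem18:
  fixes M s :: nat
    and C :: "nat \<Rightarrow> 'a::{real_inner,complete_space} set"
    and I :: "nat set"
    and N :: "nat \<Rightarrow> nat"
    and w :: "nat \<Rightarrow> nat \<Rightarrow> real"
    and J :: "nat \<Rightarrow> nat \<Rightarrow> nat list"
    and T :: "nat \<Rightarrow> 'a \<Rightarrow> 'a"
    and Ik :: "nat \<Rightarrow> nat set"
    and \<omega> :: real
    and x :: "nat \<Rightarrow> 'a"
    and e :: "nat \<Rightarrow> real"
  assumes "M \<ge> 1"
    and I_def: "I = {1..M}"
    and closed: "\<And>i. i \<in> I \<Longrightarrow> closed (C i)"
    and convex: "\<And>i. i \<in> I \<Longrightarrow> convex (C i)"
    and nonempty: "(\<Inter>i\<in>I. C i) \<noteq> {}"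
    and T_def: "\<And>k. T k = string_avg C (N k) (w k) (J k)"
    and strings: "\<And>k n. n \<in> {1..N k} \<Longrightarrow> set (J k n) \<subseteq> I"
    and weights: "\<And>k n. n \<in> {1..N k} \<Longrightarrow> 0 < w k n \<and> w k n < 1"
    and weights_sum: "\<And>k. (\<Sum>n=1..N k. w k n) = 1"
    and Ik_def: "\<And>k. Ik k = (\<Union>n\<in>{1..N k}. set (J k n))"
    and "\<omega> > 0"
    and weights_lower: "\<And>k n. n \<in> {1..N k} \<Longrightarrow> \<omega> \<le> w k n"
    and lengths: "bdd_above (range (\<lambda>k. MAX n\<in>{1..N k}. length (J k n)))"
    and "s \<ge> 1"
    and intermittent: "\<And>k. I = (\<Union>l\<in>{k..k + s - 1}. Ik l)"
    and e_nonneg: "\<And>k. 0 \<le> e k"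
    and e_summable: "summable e"
    and inexact_orbit: "\<And>k. norm (x (Suc k) - T k (x k)) \<le> e k"
  shows
    "(\<exists>x_inf \<in> (\<Inter>i\<in>I. C i). \<exists>xi_inf :: nat \<Rightarrow> 'a.
        (\<forall>i. xi_inf i \<in> (\<Inter>j\<in>I. C j)) \<and>
        (\<forall>i. weakly_converges (\<lambda>k. iterate T i k (x i)) (xi_inf i)) \<and>
        xi_inf \<longlonglongrightarrow> x_inf \<and>
        (\<forall>y k i. i \<le> k \<longrightarrow>
           \<bar>inner y (x (Suc k) - x_inf)\<bar>
             \<le> \<bar>inner y (iterate T i k (x i) - xi_inf i)\<bar> + 2 * norm y * (\<Sum>j. e (i + j))))
     \<and>
     (boundedly_regular I C \<longrightarrow>
       (\<exists>x_inf \<in> (\<Inter>i\<in>I. C i). \<exists>xi_inf :: nat \<Rightarrow> 'a.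
          (\<forall>i. xi_inf i \<in> (\<Inter>j\<in>I. C j)) \<and>
          (\<forall>i. (\<lambda>k. iterate T i k (x i)) \<longlonglongrightarrow> xi_inf i) \<and>
          xi_inf \<longlonglongrightarrow> x_inf \<and>
          (\<forall>k i. i \<le> k \<longrightarrow>
             norm (x (Suc k) - x_inf)
               \<le> norm (iterate T i k (x i) - xi_inf i) + 2 * (\<Sum>j. e (i + j)))))
     \<and>
     (boundedly_linearly_regular I C \<longrightarrow>
       (\<exists>\<kappa> c q :: real. \<exists>x_inf \<in> (\<Inter>i\<in>I. C i).
          \<kappa> > 0 \<and> c > 0 \<and> 0 < q \<and> q < 1 \<and>
          (\<forall>k i. i \<le> k \<longrightarrow>
             1 / (2 * \<kappa>) * norm (x (Suc k) - x_inf) - 2 * (\<Sum>j. e (i + j))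
               \<le> (MAX j\<in>I. infdist (x (Suc k)) (C j)) \<and>
             (MAX j\<in>I. infdist (x (Suc k)) (C j))
               \<le> c * q ^ (k - i) + 2 * (\<Sum>j. e (i + j)))))"
proof -
  \<comment> \<open>A string of at most \<open>m\<close> projections has the constant \<open>m\<close>, and averaging divides it by \<open>\<omega>\<close>.\<close>
  define B where "B = real (SUP k. MAX n\<in>{1..N k}. length (J k n)) / \<omega>"
  have I: "finite I" "I \<noteq> {}"
    using I_def \<open>M \<ge> 1\<close> by auto
  have C_ne: "C j \<noteq> {}" if "j \<in> I" for j
    using nonempty that by blast
  have string_length: "length (J k n) \<le> (SUP k. MAX n\<in>{1..N k}. length (J k n))"
    if "n \<in> {1..N k}" for k n
  proof -
    have "length (J k n) \<le> (MAX n\<in>{1..N k}. length (J k n))"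
      using that by (intro Max_ge) auto
    also have "\<dots> \<le> (SUP k. MAX n\<in>{1..N k}. length (J k n))"
      using lengths by (intro cSUP_upper) auto
    finally show ?thesis .
  qed
  have string_fejer: "strongly_fejer C (\<Inter>i\<in>I. C i) (real (SUP k. MAX n\<in>{1..N k}. length (J k n)))
      (set (J k n)) (string_proj C (J k n))" if n: "n \<in> {1..N k}" for k n
  proof -
    have "strongly_fejer C (\<Inter>i\<in>I. C i) (real (length (J k n)) * 1) (\<Union>j\<in>set (J k n). {j})
        (fold (\<lambda>j. metric_proj (C j)) (J k n))"
    proof (rule strongly_fejer_fold)
      fix j assume "j \<in> set (J k n)"
      then have "j \<in> I" using strings[OF n] by blast
      then show "strongly_fejer C (\<Inter>i\<in>I. C i) 1 {j} (metric_proj (C j))"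
        by (intro strongly_fejer_metric_proj closed convex C_ne INT_lower)
    qed simp
    then show ?thesis
      unfolding string_proj_def
      by (rule strongly_fejer_mono) (use string_length[OF n] in auto)
  qed
  have T_fejer: "strongly_fejer C (\<Inter>i\<in>I. C i) B (Ik k) (T k)" for k
  proof -
    have "T k = (\<lambda>z. \<Sum>n=1..N k. w k n *\<^sub>R string_proj C (J k n) z)"
      by (simp add: T_def string_avg_def fun_eq_iff)
    then show ?thesis
      unfolding B_def Ik_def
      using strongly_fejer_average[OF string_fejer finite_atLeastAtMost \<open>\<omega> > 0\<close> weights_lower weights_sum]
      by simp
  qed
  have T_nonexp: "norm (T k y - T k z) \<le> norm (y - z)" for k y z
    unfolding T_def string_avg_def
  proof (rule nonexpansive_average)
    fix n assume n: "n \<in> {1..N k}"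
    show "norm (string_proj C (J k n) y - string_proj C (J k n) z) \<le> norm (y - z)"
      unfolding string_proj_def
    proof (rule nonexpansive_fold)
      fix j y z assume "j \<in> set (J k n)"
      then have "j \<in> I" using strings[OF n] by blast
      then show "norm (metric_proj (C j) y - metric_proj (C j) z) \<le> norm (y - z)"
        by (intro metric_proj_nonexpansive closed convex C_ne)
    qed
    show "0 \<le> w k n" using weights[OF n] by simp
  qed (rule weights_sum)
  have "{k..k + s - 1} = {k..<k + s}" for k
    using \<open>s \<ge> 1\<close> by auto
  then have cover: "I \<subseteq> (\<Union>l\<in>{k..<k + s}. Ik l)" for k
    using intermittent[of k] by simp
  note setting = I refl nonempty closed convex T_fejer T_nonexp cover \<open>s \<ge> 1\<close>
    e_nonneg e_summable inexact_orbit
  show ?thesis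
    unfolding max_dist_def[symmetric]
    using inexact_orbit_weak[OF setting] inexact_orbit_strong[OF setting]
      inexact_orbit_linear[OF setting] by blast
qed

end
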